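(* Thompson's group $F$ has a generating set $\{x,y\}$ of two elements such that for every $m,n\in\mathbb{N}$, the set $\{x^m,y^n\}$ generates a finite index subgroup of $F$.
   Context: Thompson's group $F$ is the group (under composition) of all piecewise linear homeomorphisms of $[0,1]$ with finitely many breakpoints, all breakpoints being dyadic fractions and all slopes being integer powers of $2$. *)

theory Defs
  imports "HOL-Analysis.Analysis" "HOL-Algebra.Algebra"
begin

definition dyadic :: "real \<Rightarrow> bool" where
  "dyadic x \<longleftrightarrow> (\<exists>(k::int) (n::nat). x = of_int k / 2 ^ n)"

text \<open>Elements of Thompson's group F: piecewise linear homeomorphisms of [0,1]
  with finitely many breakpoints, all dyadic, and all slopes integer powers of 2.
  Represented as functions on the reals that are the identity outside [0,1]
  (so that equality of elements is equality of the maps on [0,1]).\<close>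
definition thompson_F_elem :: "(real \<Rightarrow> real) \<Rightarrow> bool" where
  "thompson_F_elem f \<longleftrightarrow>
     (\<exists>g. homeomorphism {0..1} {0..1} f g) \<and>
     (\<forall>x. x \<notin> {0..1} \<longrightarrow> f x = x) \<and>
     (\<exists>(k::nat) (a::nat \<Rightarrow> real).
        a 0 = 0 \<and> a k = 1 \<and>
        (\<forall>i<k. a i < a (Suc i)) \<and>
        (\<forall>i\<le>k. dyadic (a i)) \<and>
        (\<forall>i<k. \<exists>(e::int) (c::real). \<forall>x\<in>{a i..a (Suc i)}. f x = 2 powi e * x + c))"

definition thompson_F :: "(real \<Rightarrow> real) monoid" where
  "thompson_F = \<lparr>carrier = {f. thompson_F_elem f}, mult = (\<circ>), one = id\<rparr>"

end

theory Submission
  imports Defs "HOL-Number_Theory.Residues"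
begin

text \<open>
  Conjugate the interior of [0,1] to the real line by a locally finite piecewise linear map
  (\<open>line_to_unit\<close>), so that \<open>F\<close> becomes a group of dyadic piecewise linear
  homeomorphisms that are integral translations near both ends. There \<open>x\<close> is the
  translation \<open>T: t \<mapsto> t + 1\<close> and \<open>y = Z T Z\<^sup>-\<^sup>1\<close>, where \<open>Z\<close> (\<open>bend\<close>) is the
  identity on the left, doubles on the right, and is \<open>t + 1\<close> on [0,1]; so \<open>y\<close> is
  \<open>T\<close> near minus infinity and \<open>T\<^sup>2\<close> near infinity.

  Put \<open>N = mn\<close>, let \<open>H\<close> contain \<open>x\<^sup>N\<close> and \<open>y\<^sup>N\<close> and let \<open>P\<close> be its subgroup of boundedly supported
  elements. The normalizer \<open>L\<close> of \<open>P\<close> contains \<open>H\<close> and is closed under uniform agreement on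
  bounded sets. As \<open>y\<^sup>k\<^sup>N T\<^sup>-\<^sup>k\<^sup>N\<close> agrees with \<open>Z\<close> up to \<open>kN - 1\<close>, and
  \<open>y\<^sup>k\<^sup>N T\<^sup>-\<^sup>2\<^sup>k\<^sup>N\<close> for \<open>k \<rightarrow> -\<infinity>\<close> agrees with \<open>t \<mapsto> Z(t/2)\<close> on larger and larger
  half-lines, \<open>L\<close> contains \<open>Z\<close> and the dilation \<open>M: t \<mapsto> 2t\<close>. Rescaled copies
  \<open>M\<^sup>k Z M\<^sup>-\<^sup>k\<close> translate long intervals by \<open>2\<^sup>k\<close>, which for suitable \<open>k\<close> is 1 modulo the odd
  part of \<open>N\<close>; hence \<open>T\<close>, all dyadic affine maps and all dyadic one-sided dilations lie in
  \<open>L\<close>. An element of \<open>P\<close> displacing a large interval then shows that \<open>P\<close> contains all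
  commutators of compactly supported dyadic piecewise linear maps, and a normal form modulo
  \<open>P\<close> for products of one-sided dilations improves this to all such maps.

  So the subgroup generated by the powers contains every element of \<open>F\<close> that is trivial near
  0 and 1, and cosets are determined by the two end slopes modulo \<open>N\<close>.
\<close>

section \<open>The group of increasing bijections of the line\<close>

text \<open>An increasing surjection of the line is automatically continuous, so these are the
  orientation preserving homeomorphisms of the line.\<close>

typedef line_homeo = "{f :: real \<Rightarrow> real. strict_mono f \<and> surj f}"
  morphisms app Abs_line_homeo
  by (rule exI[of _ id]) (auto simp: strict_mono_def)

setup_lifting type_definition_line_homeo

lemma app_strict_mono: "strict_mono (app f)" and app_surj: "surj (app f)"
  using app[of f] by auto

lemma app_inj: "inj (app f)"
  by (rule strict_mono_imp_inj_on[OF app_strict_mono])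

lemma app_less_iff [simp]: "app f s < app f t \<longleftrightarrow> s < t"
  by (rule strict_mono_less[OF app_strict_mono])

lemma app_le_iff [simp]: "app f s \<le> app f t \<longleftrightarrow> s \<le> t"
  by (rule strict_mono_less_eq[OF app_strict_mono])

lemma app_eq_iff [simp]: "app f s = app f t \<longleftrightarrow> s = t"
  by (rule inj_eq[OF app_inj])

lemma homeo_eqI: "(\<And>t. app f t = app g t) \<Longrightarrow> f = g"
  using app_inject[of f g] by (simp add: fun_eq_iff)

text \<open>Composition is written additively, so that the simplification rules of the
  (non-commutative) class \<open>group_add\<close> apply.\<close>

instantiation line_homeo :: group_add
begin

lift_definition zero_line_homeo :: line_homeo is "\<lambda>t. t"
  by (auto simp: strict_mono_def)

lift_definition plus_line_homeo :: "line_homeo \<Rightarrow> line_homeo \<Rightarrow> line_homeo" is "\<lambda>f g t. f (g t)"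
proof -
  fix f g :: "real \<Rightarrow> real" assume *: "strict_mono f \<and> surj f" "strict_mono g \<and> surj g"
  then have "surj (\<lambda>t. f (g t))" using comp_surj[of g f] by (simp add: comp_def)
  with * show "strict_mono (\<lambda>t. f (g t)) \<and> surj (\<lambda>t. f (g t))"
    unfolding strict_mono_def by blast
qed

lift_definition uminus_line_homeo :: "line_homeo \<Rightarrow> line_homeo" is "inv_into UNIV"
proof -
  fix f :: "real \<Rightarrow> real" assume f: "strict_mono f \<and> surj f"
  have "inv_into UNIV f s < inv_into UNIV f t" if "s < t" for s t
    using f that strict_mono_less[of f "inv_into UNIV f s" "inv_into UNIV f t"]
    by (simp add: surj_f_inv_f)
  moreover have "surj (inv_into UNIV f)"
    using f by (simp add: inj_imp_surj_inv strict_mono_imp_inj_on)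
  ultimately show "strict_mono (inv_into UNIV f) \<and> surj (inv_into UNIV f)"
    by (simp add: strict_mono_def)
qed

definition minus_line_homeo :: "line_homeo \<Rightarrow> line_homeo \<Rightarrow> line_homeo" where
  "minus_line_homeo f g = f + - g"

instance
proof
  fix f g h :: line_homeo
  show "f + g + h = f + (g + h)" by (rule homeo_eqI) (simp add: plus_line_homeo.rep_eq)
  show "0 + f = f" "f + 0 = f"
    by (rule homeo_eqI, simp add: plus_line_homeo.rep_eq zero_line_homeo.rep_eq)+
  show "- f + f = 0"
    by (rule homeo_eqI) (simp add: plus_line_homeo.rep_eq zero_line_homeo.rep_eq
      uminus_line_homeo.rep_eq app_inj)
  show "f + - g = f - g" by (simp add: minus_line_homeo_def)
qed

end

lemma app_zero [simp]: "app 0 t = t"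
  by (simp add: zero_line_homeo.rep_eq)

lemma app_add [simp]: "app (f + g) t = app f (app g t)"
  by (simp add: plus_line_homeo.rep_eq)

lemma app_uminus_app [simp]: "app (- f) (app f t) = t"
  by (metis app_add app_zero left_minus)

lemma app_app_uminus [simp]: "app f (app (- f) t) = t"
  by (metis app_add app_zero right_minus)

lemma app_diff [simp]: "app (f - g) t = app f (app (- g) t)"
  using app_add[of f "- g" t] by simp

lemma app_uminus_eq_iff: "app (- f) s = t \<longleftrightarrow> s = app f t"
  by (metis app_app_uminus app_uminus_app)

lemma app_uminus_le_iff: "app (- f) s \<le> t \<longleftrightarrow> s \<le> app f t"
  by (metis app_app_uminus app_le_iff)

lemma le_app_uminus_iff: "s \<le> app (- f) t \<longleftrightarrow> app f s \<le> t"
  by (metis app_app_uminus app_le_iff)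

lemmas group_normalize = diff_conv_add_uminus minus_add add.assoc add_minus_cancel
  minus_add_cancel minus_minus right_minus left_minus add_0_left add_0_right minus_zero

section \<open>Subgroups, conjugation and commutation\<close>

definition subgrp :: "'a::group_add set \<Rightarrow> bool" where
  "subgrp S \<longleftrightarrow> 0 \<in> S \<and> (\<forall>a\<in>S. \<forall>b\<in>S. a + b \<in> S) \<and> (\<forall>a\<in>S. - a \<in> S)"

lemma subgrpI:
  assumes "0 \<in> S" "\<And>a b. a \<in> S \<Longrightarrow> b \<in> S \<Longrightarrow> a + b \<in> S" "\<And>a. a \<in> S \<Longrightarrow> - a \<in> S"
  shows "subgrp S"
  using assms by (auto simp: subgrp_def)

lemma subgrp_zero: "subgrp S \<Longrightarrow> 0 \<in> S"
  and subgrp_add: "subgrp S \<Longrightarrow> a \<in> S \<Longrightarrow> b \<in> S \<Longrightarrow> a + b \<in> S"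
  and subgrp_uminus: "subgrp S \<Longrightarrow> a \<in> S \<Longrightarrow> - a \<in> S"
  by (auto simp: subgrp_def)

lemma subgrp_diff: "subgrp S \<Longrightarrow> a \<in> S \<Longrightarrow> b \<in> S \<Longrightarrow> a - b \<in> S"
  by (metis diff_conv_add_uminus subgrp_add subgrp_uminus)

text \<open>The points moved by \<open>p\<close> are permuted by \<open>p\<close>, so on the image
  of this set both conjugates are computed from the common values; every other point is fixed by
  both. Conjugating a boundedly supported element is thus a local matter.\<close>

lemma conj_agree:
  assumes "\<And>t. app p t \<noteq> t \<Longrightarrow> app u t = app v t"
  shows "u + p - u = v + p - v"
proof (rule homeo_eqI)
  fix t
  define s where "s = app (- v) t"
  have t: "t = app v s" by (simp add: s_def)
  show "app (u + p - u) t = app (v + p - v) t"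
  proof (cases "app p s = s")
    case True
    define r where "r = app (- u) t"
    have tr: "t = app u r" by (simp add: r_def)
    have "app p r = r"
      using assms[of r] t tr True by (metis app_eq_iff)
    then show ?thesis
      using True by (simp add: s_def[symmetric] r_def[symmetric] t[symmetric] tr[symmetric])
  next
    case False
    then have "app u s = app v s" "app u (app p s) = app v (app p s)"
      using assms by auto
    then show ?thesis
      by (simp add: t) (metis app_uminus_app)
  qed
qed

text \<open>Each map permutes the points it moves, so a point moved by one map and its image are
  both fixed by the other.\<close>

lemma commute_disjoint:
  assumes "\<And>t. app f t = t \<or> app g t = t"
  shows "f + g = g + f"
proof (rule homeo_eqI)
  fix t show "app (f + g) t = app (g + f) t"
    using assms[of t] assms[of "app f t"] assms[of "app g t"] by auto
qed

subsection \<open>Dyadic affine maps and one-sided dilations\<close>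

lemma dyadic_of_int [simp]: "dyadic (of_int k)"
  unfolding dyadic_def by (rule exI[of _ k], rule exI[of _ 0]) simp

lemma dyadic_0 [simp]: "dyadic 0" and dyadic_1 [simp]: "dyadic 1"
  and dyadic_numeral [simp]: "dyadic (numeral w)"
  using dyadic_of_int[of 0] dyadic_of_int[of 1] dyadic_of_int[of "numeral w"] by simp_all

lemma dyadic_uminus [simp]: "dyadic (- x) \<longleftrightarrow> dyadic x"
proof -
  have "dyadic (- x)" if "dyadic x" for x
    using that unfolding dyadic_def by (metis minus_divide_left of_int_minus)
  from this[of x] this[of "- x"] show ?thesis by auto
qed

lemma dyadic_add [intro]:
  assumes "dyadic x" "dyadic y" shows "dyadic (x + y)"
proof -
  obtain k n l m where "x = of_int k / 2 ^ n" "y = of_int l / 2 ^ m"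
    using assms by (auto simp: dyadic_def)
  then have "x + y = of_int (k * 2 ^ m + l * 2 ^ n) / 2 ^ (n + m)"
    by (simp add: add_divide_distrib power_add)
  then show ?thesis unfolding dyadic_def by blast
qed

lemma dyadic_diff [intro]: "dyadic x \<Longrightarrow> dyadic y \<Longrightarrow> dyadic (x - y)"
  using dyadic_add[of x "- y"] by simp

lemma dyadic_mult [intro]:
  assumes "dyadic x" "dyadic y" shows "dyadic (x * y)"
proof -
  obtain k n l m where "x = of_int k / 2 ^ n" "y = of_int l / 2 ^ m"
    using assms by (auto simp: dyadic_def)
  then have "x * y = of_int (k * l) / 2 ^ (n + m)"
    by (simp add: power_add)
  then show ?thesis unfolding dyadic_def by blast
qed

lemma dyadic_powi [simp]: "dyadic (2 powi e)"
proof (cases "e \<ge> 0")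
  case True
  then have "(2::real) powi e = of_int (2 ^ nat e)" by (simp add: power_int_def)
  then show ?thesis by (metis dyadic_of_int)
next
  case False
  then have "(2::real) powi e = of_int 1 / 2 ^ nat (- e)"
    by (simp add: power_int_def field_simps)
  then show ?thesis unfolding dyadic_def by blast
qed

lemma dyadic_divide_numeral [simp]: "dyadic (x / 2 ^ n) \<longleftrightarrow> dyadic x"
proof
  assume "dyadic (x / 2 ^ n)"
  from dyadic_mult[OF this dyadic_powi[of "int n"]] show "dyadic x" by simp
next
  assume "dyadic x"
  from dyadic_mult[OF this dyadic_powi[of "- int n"]] show "dyadic (x / 2 ^ n)"
    by (simp add: power_int_minus field_simps)
qed

lift_definition aff :: "int \<Rightarrow> real \<Rightarrow> line_homeo" is "\<lambda>e c t. 2 powi e * t + c"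
proof -
  fix e and c :: real
  have "\<exists>t. s = 2 powi e * t + c" for s
    by (rule exI[of _ "(s - c) / 2 powi e"]) simp
  then show "strict_mono (\<lambda>t. 2 powi e * t + c) \<and> surj (\<lambda>t. 2 powi e * t + c)"
    by (auto simp: strict_mono_def surj_def)
qed

lemma app_aff [simp]: "app (aff e c) t = 2 powi e * t + c"
  by (simp add: aff.rep_eq)

text \<open>In a product of such one-sided dilations the centre of a factor refers to values of the
  factors to its right: it is the image of a breakpoint, not the breakpoint itself.\<close>

lift_definition kink :: "real \<Rightarrow> int \<Rightarrow> line_homeo" is
  "\<lambda>b e t. if t \<le> b then t else b + 2 powi e * (t - b)"
proof -
  fix b :: real and e
  have pos: "(2::real) powi e > 0" by simp
  have "\<exists>t. s = (if t \<le> b then t else b + 2 powi e * (t - b))" for s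
    using pos by (intro exI[of _ "if s \<le> b then s else b + (s - b) / 2 powi e"])
      (auto simp: field_simps)
  moreover have "s \<le> b \<Longrightarrow> t > b \<Longrightarrow> s < b + 2 powi e * (t - b)" for s t
    using pos mult_pos_pos[of "2 powi e" "t - b"] by linarith
  ultimately show "strict_mono (\<lambda>t. if t \<le> b then t else b + 2 powi e * (t - b)) \<and>
      surj (\<lambda>t. if t \<le> b then t else b + 2 powi e * (t - b))"
    unfolding strict_mono_def surj_def by auto
qed

lemma app_kink: "app (kink b e) t = (if t \<le> b then t else b + 2 powi e * (t - b))"
  by (simp add: kink.rep_eq)

lemma app_kink_le [simp]: "t \<le> b \<Longrightarrow> app (kink b e) t = t"
  and app_kink_ge: "b \<le> t \<Longrightarrow> app (kink b e) t = b + 2 powi e * (t - b)"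
  by (auto simp: app_kink)

lemma kink_uminus: "- kink b e = kink b (- e)"
proof -
  have "kink b (- e) + kink b e = 0"
  proof (rule homeo_eqI)
    fix t
    have "t > b \<Longrightarrow> 2 powi e * (t - b) > 0" by simp
    then show "app (kink b (- e) + kink b e) t = app 0 t"
      by (auto simp: app_kink power_int_minus field_simps)
  qed
  then show ?thesis using eq_neg_iff_add_eq_0[of "kink b (- e)" "kink b e"] by simp
qed

lemma aff_add: "aff e c + aff e' c' = aff (e + e') (2 powi e * c' + c)"
proof (rule homeo_eqI)
  fix t
  have "(2::real) powi (e + e') = 2 powi e * 2 powi e'" by (simp add: power_int_add)
  then show "app (aff e c + aff e' c') t = app (aff (e + e') (2 powi e * c' + c)) t"
    by (simp add: algebra_simps)
qed

lemma aff_zero: "aff 0 0 = 0"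
  by (rule homeo_eqI) simp

lemma aff_uminus: "- aff e c = aff (- e) (- (2 powi (- e) * c))"
proof -
  have "aff (- e) (- (2 powi (- e) * c)) + aff e c = 0"
    by (simp add: aff_add aff_zero)
  then show ?thesis
    using eq_neg_iff_add_eq_0[of "aff (- e) (- (2 powi (- e) * c))" "aff e c"] by simp
qed

lemma aff_conj_kink: "aff d c + kink b e - aff d c = kink (2 powi d * b + c) e"
proof -
  have "aff d c + kink b e = kink (2 powi d * b + c) e + aff d c"
  proof (rule homeo_eqI)
    fix t
    show "app (aff d c + kink b e) t = app (kink (2 powi d * b + c) e + aff d c) t"
    proof (cases "t \<le> b")
      case True
      then have "2 powi d * t + c \<le> 2 powi d * b + c" by simp
      with True show ?thesis by simp
    next
      case False
      then have "2 powi d * b + c \<le> 2 powi d * t + c" by simp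
      with False show ?thesis by (simp add: app_kink_ge algebra_simps)
    qed
  qed
  then show ?thesis by (simp only: group_normalize)
qed

lemma app_uminus_aff0 [simp]: "app (- aff 0 c) t = t - c"
  by (simp add: app_uminus_eq_iff)

lemma app_uminus_scale [simp]: "app (- aff e 0) t = t / 2 powi e"
  by (simp add: app_uminus_eq_iff)

lemma aff_conj_translation: "aff d 0 + aff 0 c - aff d 0 = aff 0 (2 powi d * c)"
  by (rule homeo_eqI) (simp add: algebra_simps)

lemma kink_add: "kink b e + kink b e' = kink b (e + e')"
proof (rule homeo_eqI)
  fix t
  have "(2::real) powi (e + e') = 2 powi e * 2 powi e'" by (simp add: power_int_add)
  moreover have "b \<le> t \<Longrightarrow> b \<le> app (kink b e') t" by (simp add: app_kink_ge)
  ultimately show "app (kink b e + kink b e') t = app (kink b (e + e')) t"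
    by (cases "t \<le> b") (simp_all add: app_kink_ge)
qed

lemma kink_zero: "kink b 0 = 0"
  by (rule homeo_eqI) (simp add: app_kink)

text \<open>To the right of \<open>c\<close> the map \<open>kink c 1\<close> is the dilation about
  \<open>c\<close>, which carries the half-line where \<open>kink a 1\<close> acts to the one
  starting at \<open>2 * a - c\<close>.\<close>

lemma kink_add_kink:
  assumes "c \<le> a"
  shows "kink c 1 + kink a 1 = kink (2 * a - c) 1 + kink c 1"
proof (rule homeo_eqI)
  fix t show "app (kink c 1 + kink a 1) t = app (kink (2 * a - c) 1 + kink c 1) t"
    using assms by (auto simp: app_kink)
qed

lemma subgrp_int_family:
  fixes x :: "int \<Rightarrow> 'a::group_add"
  assumes S: "subgrp S" and "x 1 \<in> S" and add: "\<And>i j. x (i + j) = x i + x j"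
  shows "x i \<in> S"
proof -
  have "x 0 + x 0 = x 0 + 0" using add[of 0 0] by simp
  then have 0: "x 0 = 0" by (simp only: add_left_cancel)
  have "x (-1) = - x 1" using add[of "-1" 1] 0 by (simp add: eq_neg_iff_add_eq_0)
  then have m1: "x (-1) \<in> S" using assms(2) subgrp_uminus[OF S] by simp
  show ?thesis
  proof (induction i rule: int_induct[where k = 0])
    case base then show ?case using 0 subgrp_zero[OF S] by simp
  next
    case (step1 i) then show ?case using add[of i 1] assms(2) subgrp_add[OF S] by simp
  next
    case (step2 i) then show ?case using add[of i "-1"] m1 subgrp_add[OF S] by simp
  qed
qed

subsection \<open>Piecewise linear maps with trivial germ at minus infinity\<close>

text \<open>Every dyadic piecewise linear map with slopes powers of 2 that is the identity near
  minus infinity is such a product. The inductive form lets closure properties be checked one kink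
  at a time.\<close>

inductive_set pl_plus :: "line_homeo set" where
  pl_plus_0: "0 \<in> pl_plus"
| pl_plus_step: "g \<in> pl_plus \<Longrightarrow> dyadic b \<Longrightarrow> kink b e + g \<in> pl_plus"

lemma kink_in_pl_plus: "dyadic b \<Longrightarrow> kink b e \<in> pl_plus"
  using pl_plus_step[OF pl_plus_0, of b e] by simp

lemma subgrp_pl_plus: "subgrp pl_plus"
proof -
  have add: "f + g \<in> pl_plus" if "f \<in> pl_plus" "g \<in> pl_plus" for f g
    using that
    by (induction f rule: pl_plus.induct) (auto simp: add.assoc intro: pl_plus_step)
  have "- f \<in> pl_plus" if "f \<in> pl_plus" for f
    using that
  proof (induction rule: pl_plus.induct)
    case (pl_plus_step g b e)
    then have "- g + kink b (- e) \<in> pl_plus"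
      by (intro add kink_in_pl_plus)
    then show ?case by (simp only: minus_add kink_uminus)
  qed (simp add: pl_plus_0)
  with add show ?thesis by (intro subgrpI pl_plus_0)
qed

lemma pl_plus_least:
  assumes S: "subgrp S" and kink: "\<And>b. dyadic b \<Longrightarrow> kink b 1 \<in> S"
  shows "pl_plus \<subseteq> S"
proof
  have all: "kink b e \<in> S" if "dyadic b" for b e
    by (rule subgrp_int_family[OF S]) (auto simp: kink_add kink that)
  show "f \<in> S" if "f \<in> pl_plus" for f
    using that by (induction rule: pl_plus.induct) (auto intro: all subgrp_zero[OF S] subgrp_add[OF S])
qed

lemma pl_plus_conj_aff:
  assumes "f \<in> pl_plus" "dyadic c"
  shows "aff d c + f - aff d c \<in> pl_plus"
  using assms(1)
proof (induction rule: pl_plus.induct)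
  case (pl_plus_step g b e)
  have "aff d c + (kink b e + g) - aff d c = kink (2 powi d * b + c) e + (aff d c + g - aff d c)"
    unfolding aff_conj_kink[symmetric] by (simp only: group_normalize)
  with pl_plus_step show ?case
    using assms(2) by (auto intro!: pl_plus.pl_plus_step dyadic_add dyadic_mult)
qed (simp add: pl_plus_0)

lemma pl_plus_left: "f \<in> pl_plus \<Longrightarrow> \<exists>A. \<forall>t\<le>A. app f t = t"
proof (induction rule: pl_plus.induct)
  case (pl_plus_step g b e)
  then obtain A where "\<forall>t\<le>A. app g t = t" by blast
  then show ?case by (intro exI[of _ "min A b"]) simp
qed simp

lemma pl_plus_dyadic:
  assumes "f \<in> pl_plus" "dyadic t" shows "dyadic (app f t)"
  using assms(1)
proof (induction rule: pl_plus.induct)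
  case (pl_plus_step g b e)
  then show ?case by (auto simp: app_kink intro!: dyadic_add dyadic_mult dyadic_diff)
qed (simp add: assms)

section \<open>Germs at plus infinity, compact and bounded support\<close>

definition agree_top :: "line_homeo \<Rightarrow> line_homeo \<Rightarrow> bool" where
  "agree_top f g \<longleftrightarrow> (\<exists>A. \<forall>t\<ge>A. app f t = app g t)"

lemma agree_top_refl [simp]: "agree_top f f"
  by (simp add: agree_top_def)

lemma agree_top_sym: "agree_top f g \<Longrightarrow> agree_top g f"
  unfolding agree_top_def by metis

lemma agree_top_trans: 
  assumes "agree_top f g" "agree_top g h" shows "agree_top f h"
proof -
  obtain A B where "\<forall>t\<ge>A. app f t = app g t" "\<forall>t\<ge>B. app g t = app h t"
    using assms by (auto simp: agree_top_def)
  then have "\<forall>t\<ge>max A B. app f t = app h t" by auto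
  then show ?thesis unfolding agree_top_def by blast
qed

lemma agree_top_add:
  assumes "agree_top f f'" "agree_top g g'" shows "agree_top (f + g) (f' + g')"
proof -
  obtain A B where A: "\<forall>t\<ge>A. app f t = app f' t" and B: "\<forall>t\<ge>B. app g t = app g' t"
    using assms by (auto simp: agree_top_def)
  have "app (f + g) t = app (f' + g') t" if "t \<ge> max B (app (- g) A)" for t
  proof -
    have "app g t \<ge> A" using that by (simp add: app_uminus_le_iff)
    then show ?thesis using A B that by simp
  qed
  then show ?thesis unfolding agree_top_def by blast
qed

lemma agree_top_uminus:
  assumes "agree_top f g" shows "agree_top (- f) (- g)"
proof -
  have "agree_top (- g + g - f) (- g + f - f)"
    unfolding diff_conv_add_uminus using assms
    by (intro agree_top_add agree_top_refl) (rule agree_top_sym)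
  then show ?thesis by (simp only: group_normalize)
qed

lemma agree_top_diff:
  "agree_top f f' \<Longrightarrow> agree_top g g' \<Longrightarrow> agree_top (f - g) (f' - g')"
  unfolding diff_conv_add_uminus by (intro agree_top_add agree_top_uminus)

lemma agree_top_kink: "agree_top (kink b e) (aff e (b - 2 powi e * b))"
  unfolding agree_top_def by (rule exI[of _ b]) (simp add: app_kink_ge algebra_simps)

lemma two_powi_inject:
  assumes "(2::real) powi i = 2 powi j" shows "i = j"
  using assms power_int_strict_increasing[of i j "2::real"] power_int_strict_increasing[of j i "2::real"]
  by (cases i j rule: linorder_cases) auto

lemma agree_top_aff_cong:
  assumes "agree_top (aff e c) (aff e' c')" shows "e = e' \<and> c = c'"
proof -
  obtain A where A: "\<forall>t\<ge>A. 2 powi e * t + c = 2 powi e' * t + c'"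
    using assms by (auto simp: agree_top_def)
  from A[rule_format, of A] A[rule_format, of "A + 1"]
  have eq: "(2::real) powi e = 2 powi e'" by (simp add: algebra_simps)
  then have "c = c'" using A[rule_format, of A] by simp
  have "e = e'" using eq by (rule two_powi_inject)
  with \<open>c = c'\<close> show ?thesis by simp
qed

definition pl_compact :: "line_homeo set" where
  "pl_compact = {f \<in> pl_plus. agree_top f 0}"

lemma subgrp_pl_compact: "subgrp pl_compact"
proof (rule subgrpI)
  show "0 \<in> pl_compact" by (simp add: pl_compact_def pl_plus_0)
  show "a + b \<in> pl_compact" if "a \<in> pl_compact" "b \<in> pl_compact" for a b
    using that agree_top_add[of a 0 b 0] subgrp_add[OF subgrp_pl_plus]
    by (auto simp: pl_compact_def)
  show "- a \<in> pl_compact" if "a \<in> pl_compact" for a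
    using that agree_top_uminus[of a 0] subgrp_uminus[OF subgrp_pl_plus]
    by (auto simp: pl_compact_def)
qed

definition bounded_support :: "line_homeo \<Rightarrow> bool" where
  "bounded_support f \<longleftrightarrow> (\<exists>A. \<forall>t. \<bar>t\<bar> \<ge> A \<longrightarrow> app f t = t)"

lemma bounded_supportE:
  assumes "bounded_support f"
  obtains A where "A \<ge> B" "\<And>t. \<bar>t\<bar> \<ge> A \<Longrightarrow> app f t = t"
proof -
  obtain A where A: "\<forall>t. \<bar>t\<bar> \<ge> A \<longrightarrow> app f t = t"
    using assms by (auto simp: bounded_support_def)
  show thesis by (rule that[of "max A B"]) (use A in auto)
qed

lemma bounded_support_pl_compact: "f \<in> pl_compact \<Longrightarrow> bounded_support f"
proof -
  assume "f \<in> pl_compact"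
  then obtain A B where A: "\<forall>t\<le>A. app f t = t" and B: "\<forall>t\<ge>B. app f t = t"
    using pl_plus_left unfolding pl_compact_def agree_top_def by fastforce
  have "app f t = t" if "\<bar>t\<bar> \<ge> max B (- A)" for t
    using that A B by (cases "t \<ge> 0") auto
  then show ?thesis unfolding bounded_support_def by blast
qed

lemma bounded_support_add:
  assumes "bounded_support f" "bounded_support g" shows "bounded_support (f + g)"
proof -
  obtain A where A: "\<And>t. \<bar>t\<bar> \<ge> A \<Longrightarrow> app f t = t"
    using bounded_supportE[OF assms(1)] by blast
  obtain B where B: "B \<ge> A" "\<And>t. \<bar>t\<bar> \<ge> B \<Longrightarrow> app g t = t"
    using bounded_supportE[OF assms(2)] by blast
  have "app (f + g) t = t" if "\<bar>t\<bar> \<ge> B" for t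
    using A B that by auto
  then show ?thesis unfolding bounded_support_def by blast
qed

lemma bounded_support_uminus:
  assumes "bounded_support f" shows "bounded_support (- f)"
proof -
  obtain A where "\<And>t. \<bar>t\<bar> \<ge> A \<Longrightarrow> app f t = t"
    using bounded_supportE[OF assms(1)] by blast
  then have "app (- f) t = t" if "\<bar>t\<bar> \<ge> A" for t
    using that by (simp add: app_uminus_eq_iff)
  then show ?thesis unfolding bounded_support_def by blast
qed

lemma bounded_support_conj:
  assumes "bounded_support f" shows "bounded_support (u + f - u)"
proof -
  obtain A where A: "\<And>t. \<bar>t\<bar> \<ge> A \<Longrightarrow> app f t = t" and "A \<ge> 0"
    using bounded_supportE[OF assms(1)] by blast
  define B where "B = max (app u A) (- app u (- A))"
  have "app (u + f - u) t = t" if "\<bar>t\<bar> \<ge> B" for t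
  proof -
    have "t \<ge> app u A \<or> t \<le> app u (- A)" using that by (auto simp: B_def)
    then have "app (- u) t \<ge> A \<or> app (- u) t \<le> - A"
      by (simp add: le_app_uminus_iff app_uminus_le_iff)
    then have "app f (app (- u) t) = app (- u) t" by (intro A) auto
    then show ?thesis by simp
  qed
  then show ?thesis unfolding bounded_support_def by blast
qed

lemma bounded_support_agree_top: "bounded_support f \<Longrightarrow> agree_top f 0"
proof -
  assume "bounded_support f"
  then obtain A where A: "\<And>t. \<bar>t\<bar> \<ge> A \<Longrightarrow> app f t = t" and "A \<ge> 0"
    using bounded_supportE by blast
  then show ?thesis unfolding agree_top_def by (intro exI[of _ A]) simp
qed

text \<open>Maps with truncations form a group: for a product, truncate the right factor up to
  \<open>A\<close> and the left one up to the image of \<open>A\<close>. Hence only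
  \<open>kink b 1\<close> needs an explicit truncation.\<close>

lemma pl_plus_truncate:
  assumes "u \<in> pl_plus"
  shows "\<exists>k\<in>pl_compact. \<forall>t\<le>A. app k t = app u t"
proof -
  define S where "S = {u. \<forall>A. \<exists>k\<in>pl_compact. \<forall>t\<le>A. app k t = app u t}"
  have "subgrp S"
  proof (rule subgrpI)
    show "0 \<in> S" unfolding S_def using subgrp_zero[OF subgrp_pl_compact] by blast
    show "u + v \<in> S" if uv: "u \<in> S" "v \<in> S" for u v
      unfolding S_def
    proof (intro CollectI allI)
      fix A :: real
      obtain k where k: "k \<in> pl_compact" "\<forall>t\<le>A. app k t = app v t"
        using uv(2) unfolding S_def by blast
      obtain l where l: "l \<in> pl_compact" "\<forall>t\<le>app v A. app l t = app u t"
        using uv(1) unfolding S_def by blast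
      have "\<forall>t\<le>A. app (l + k) t = app (u + v) t"
        using k l by simp
      then show "\<exists>k\<in>pl_compact. \<forall>t\<le>A. app k t = app (u + v) t"
        using k l subgrp_add[OF subgrp_pl_compact] by blast
    qed
    show "- u \<in> S" if u: "u \<in> S" for u
      unfolding S_def
    proof (intro CollectI allI)
      fix A :: real
      obtain k where k: "k \<in> pl_compact" "\<forall>t\<le>app (- u) A. app k t = app u t"
        using u unfolding S_def by blast
      have "app (- k) t = app (- u) t" if "t \<le> A" for t
        using k(2)[rule_format, of "app (- u) t"] that by (simp add: app_uminus_eq_iff)
      then show "\<exists>k\<in>pl_compact. \<forall>t\<le>A. app k t = app (- u) t"
        using k subgrp_uminus[OF subgrp_pl_compact] by blast
    qed
  qed
  moreover have "kink b 1 \<in> S" if b: "dyadic b" for b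
    unfolding S_def
  proof (intro CollectI allI)
    fix A :: real
    define a where "a = max b (of_int \<lceil>A\<rceil>)"
    have "dyadic a" "b \<le> a" using b by (auto simp: a_def max_def)
    have "A \<le> a" using le_of_int_ceiling[of A] unfolding a_def by linarith
    \<comment> \<open>Slope 2 from \<open>b\<close> to \<open>a\<close>, then slope 1/2 from height
      \<open>2 * a - b\<close> until the diagonal is met at \<open>3 * a - 2 * b\<close>, then the
      identity.\<close>
    define k where "k = kink (3 * a - 2 * b) 1 + (kink (2 * a - b) (- 2) + kink b 1)"
    have "k \<in> pl_plus"
      unfolding k_def using \<open>dyadic a\<close> \<open>dyadic b\<close>
      by (intro subgrp_add[OF subgrp_pl_plus] kink_in_pl_plus dyadic_diff dyadic_mult dyadic_numeral)
    moreover have "app k t = app 0 t" if "t \<ge> 3 * a - 2 * b" for t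
      using that \<open>b \<le> a\<close> by (auto simp: k_def app_kink power_int_minus field_simps)
    then have "agree_top k 0" unfolding agree_top_def by blast
    moreover have "app k t = app (kink b 1) t" if "t \<le> A" for t
      using that \<open>b \<le> a\<close> \<open>A \<le> a\<close> by (auto simp: k_def app_kink)
    ultimately show "\<exists>k\<in>pl_compact. \<forall>t\<le>A. app k t = app (kink b 1) t"
      unfolding pl_compact_def by blast
  qed
  ultimately have "pl_plus \<subseteq> S" by (rule pl_plus_least)
  with assms show ?thesis unfolding S_def by blast
qed

section \<open>Groups generated by powers of the two line maps\<close>

text \<open>The breakpoints -1, 0, 1 have the images -1, 1, 2, which are the centres of the
  factors.\<close>

definition bend :: line_homeo where
  "bend = kink 2 1 + kink 1 (- 1) + kink (- 1) 1"

lemma app_bend: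
  "app bend t = (if t \<le> -1 then t else if t \<le> 0 then 2 * t + 1 else if t \<le> 1 then t + 1 else 2 * t)"
  by (auto simp: bend_def app_kink power_int_minus field_simps)

lemma app_uminus_bend_low: "s \<le> -1 \<Longrightarrow> app (- bend) s = s"
  and app_uminus_bend_high: "s \<ge> 2 \<Longrightarrow> app (- bend) s = s / 2"
  unfolding app_uminus_eq_iff app_bend by auto

lemma exists_power_two_cong_1:
  fixes n :: nat and B :: real
  assumes "odd n"
  obtains k where "2 ^ k \<ge> B" "[2 ^ k = 1] (mod int n)"
proof -
  have "coprime 2 n" using assms by simp
  then have 1: "[2 ^ totient n = 1] (mod n)" by (rule euler_theorem)
  have "totient n \<ge> 1" using assms by (cases "n = 0") (auto simp: Suc_le_eq)
  define m where "m = nat \<lceil>B\<rceil>"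
  have "B \<le> real m" unfolding m_def by linarith
  also have "\<dots> \<le> 2 ^ m" using of_nat_mono[OF less_imp_le[OF less_exp[of m]]] by simp
  also have "\<dots> \<le> 2 ^ (totient n * m)"
    using \<open>totient n \<ge> 1\<close> by (intro power_increasing) auto
  finally have "B \<le> 2 ^ (totient n * m)" .
  moreover have "[2 ^ (totient n * m) = 1] (mod n)"
    using cong_pow[OF 1, of m] by (simp add: power_mult)
  then have "[2 ^ (totient n * m) = 1] (mod int n)"
    by (metis cong_int_iff of_nat_1 of_nat_numeral of_nat_power)
  ultimately show thesis by (rule that)
qed

locale translation_powers =
  fixes N :: nat and H :: "line_homeo set"
  assumes N_pos: "N > 0"
    and subgrp_H: "subgrp H"
    and translation_H: "\<And>j::int. aff 0 (of_int j * real N) \<in> H"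
    and conj_translation_H: "\<And>j::int. bend + aff 0 (of_int j * real N) - bend \<in> H"
begin

section \<open>The bounded part of the group and its normalizer\<close>

definition P :: "line_homeo set" where
  "P = {h \<in> H. bounded_support h}"

text \<open>Both inclusions are demanded, so that closure under inverses is immediate.\<close>

definition L :: "line_homeo set" where
  "L = {u. \<forall>p\<in>P. u + p - u \<in> P \<and> - u + p + u \<in> P}"

lemma subgrp_P: "subgrp P"
  using subgrp_H bounded_support_add bounded_support_uminus
  by (auto simp: P_def subgrp_def bounded_support_def)

lemma L_conj: "u \<in> L \<Longrightarrow> p \<in> P \<Longrightarrow> u + p - u \<in> P"
  and L_conj': "u \<in> L \<Longrightarrow> p \<in> P \<Longrightarrow> - u + p + u \<in> P"
  by (auto simp: L_def)

lemma subgrp_L: "subgrp L"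
proof (rule subgrpI)
  show "0 \<in> L" by (simp add: L_def)
  show "- u \<in> L" if "u \<in> L" for u
    using that unfolding L_def by (simp only: group_normalize) auto
  show "u + v \<in> L" if "u \<in> L" "v \<in> L" for u v
    unfolding L_def
  proof (intro CollectI ballI conjI)
    fix p assume "p \<in> P"
    have "u + (v + p - v) - u \<in> P" using that \<open>p \<in> P\<close> by (intro L_conj)
    then show "u + v + p - (u + v) \<in> P" by (simp only: group_normalize)
    have "- v + (- u + p + u) + v \<in> P" using that \<open>p \<in> P\<close> by (intro L_conj')
    then show "- (u + v) + p + (u + v) \<in> P" by (simp only: group_normalize)
  qed
qed

lemma H_subset_L: "H \<subseteq> L"
proof
  fix u assume u: "u \<in> H"
  have "u + p - u \<in> P" if "u \<in> H" "p \<in> P" for u p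
    using that bounded_support_conj subgrp_add[OF subgrp_H] subgrp_diff[OF subgrp_H]
    by (auto simp: P_def)
  from this[OF u] this[OF subgrp_uminus[OF subgrp_H u]] show "u \<in> L"
    by (simp add: L_def)
qed

text \<open>Conjugation of an element of \<open>P\<close> only depends on the conjugator on its bounded support.\<close>

lemma L_closed:
  assumes "\<And>A. \<exists>l\<in>L. \<forall>t. \<bar>t\<bar> \<le> A \<longrightarrow> app l t = app u t"
  shows "u \<in> L"
  unfolding L_def
proof (intro CollectI ballI)
  fix p assume p: "p \<in> P"
  then obtain A where A: "\<And>t. \<bar>t\<bar> \<ge> A \<Longrightarrow> app p t = t"
    using bounded_supportE[of p] unfolding P_def by blast
  obtain l where l: "l \<in> L" "\<And>t. \<bar>t\<bar> \<le> A \<Longrightarrow> app l t = app u t"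
    using assms[of A] by blast
  have "u + p - u = l + p - l"
    using A l(2) by (intro conj_agree) (metis linorder_le_cases)
  moreover
  \<comment> \<open>For the inverse conjugation the inverses must agree on the support of
    \<open>p\<close>, so \<open>m\<close> has to agree with \<open>u\<close> on the preimage of
    \<open>[-A, A]\<close> under \<open>u\<close>.\<close>
  define B where "B = max \<bar>app (- u) A\<bar> \<bar>app (- u) (- A)\<bar>"
  obtain m where m: "m \<in> L" "\<And>t. \<bar>t\<bar> \<le> B \<Longrightarrow> app m t = app u t"
    using assms[of B] by blast
  have "app (- u) t = app (- m) t" if "app p t \<noteq> t" for t
  proof -
    have "\<bar>t\<bar> \<le> A" using A[of t] that by linarith
    then have "app (- u) t \<le> app (- u) A" "app (- u) (- A) \<le> app (- u) t" by auto
    then have "\<bar>app (- u) t\<bar> \<le> B" unfolding B_def by linarith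
    from m(2)[OF this] show ?thesis by (metis app_app_uminus app_uminus_app)
  qed
  then have "- u + p - (- u) = - m + p - (- m)" by (rule conj_agree)
  ultimately show "u + p - u \<in> P \<and> - u + p + u \<in> P"
    using L_conj[OF l(1) p] L_conj'[OF m(1) p] by simp
qed

section \<open>Dyadic maps in the normalizer\<close>

lemma bend_in_L: "bend \<in> L"
proof (rule L_closed)
  fix A :: real
  \<comment> \<open>Chosen so that subtracting \<open>j * N\<close> moves \<open>[-A, A]\<close>
    left of -1, where the inverse of \<open>bend\<close> is the identity; the two translations then
    cancel and \<open>bend\<close> remains.\<close>
  define j where "j = max 0 \<lceil>A + 1\<rceil>"
  have "A + 1 \<le> of_int j" "j \<ge> 0" unfolding j_def by linarith+
  moreover have "of_int j * 1 \<le> of_int j * real N"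
    using N_pos \<open>j \<ge> 0\<close> by (intro mult_left_mono) auto
  ultimately have j: "A + 1 \<le> of_int j * real N" by linarith
  define l where "l = bend + aff 0 (of_int j * real N) - bend - aff 0 (of_int j * real N)"
  have "l \<in> H" unfolding l_def
    by (intro subgrp_diff[OF subgrp_H] conj_translation_H translation_H)
  moreover have "app l t = app bend t" if "\<bar>t\<bar> \<le> A" for t
  proof -
    have "t - of_int j * real N \<le> -1" using that j by linarith
    then show ?thesis by (simp add: l_def app_uminus_bend_low)
  qed
  ultimately show "\<exists>l\<in>L. \<forall>t. \<bar>t\<bar> \<le> A \<longrightarrow> app l t = app bend t"
    using H_subset_L by blast
qed

lemma bend_scale_in_L: "bend - aff 1 0 \<in> L"
proof (rule L_closed)
  fix A :: real
  \<comment> \<open>Nonpositive, so that subtracting \<open>2 * j * N\<close> moves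
    \<open>[-A, A]\<close> right of 2, where the inverse of \<open>bend\<close> halves; the halved
    shift cancels against the inner translation, leaving \<open>bend\<close> applied to
    \<open>t / 2\<close>.\<close>
  define j where "j = min 0 (- \<lceil>A + 2\<rceil>)"
  have "A + 2 \<le> - of_int j" "j \<le> 0" unfolding j_def by linarith+
  moreover have "- of_int j * 1 \<le> - of_int j * real N"
    using N_pos \<open>j \<le> 0\<close> by (intro mult_left_mono) auto
  ultimately have j: "A + 2 \<le> - of_int j * real N" "- of_int j * real N \<ge> 0"
    using N_pos by (auto simp: mult_le_0_iff)
  define l where "l = bend + aff 0 (of_int j * real N) - bend - aff 0 (of_int (2 * j) * real N)"
  have "l \<in> H" unfolding l_def
    by (intro subgrp_diff[OF subgrp_H] conj_translation_H translation_H)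
  moreover have "app l t = app (bend - aff 1 0) t" if "\<bar>t\<bar> \<le> A" for t
  proof -
    have "t - of_int (2 * j) * real N \<ge> 2" using that j by (simp add: algebra_simps)
    then show ?thesis by (simp add: l_def app_uminus_bend_high field_simps)
  qed
  ultimately show "\<exists>l\<in>L. \<forall>t. \<bar>t\<bar> \<le> A \<longrightarrow> app l t = app (bend - aff 1 0) t"
    using H_subset_L by blast
qed

lemma scale_in_L: "aff k 0 \<in> L"
proof (rule subgrp_int_family[OF subgrp_L])
  have "- (bend - aff 1 0) + bend \<in> L"
    by (intro subgrp_add[OF subgrp_L] subgrp_uminus[OF subgrp_L] bend_scale_in_L bend_in_L)
  then show "aff 1 0 \<in> L" by (simp only: group_normalize)
qed (simp add: aff_add)

lemma translation_in_L: "aff 0 1 \<in> L"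
proof -
  obtain s n where sn: "N = 2 ^ s * n" "odd n"
    using multiplicity_decompose'[of N 2] N_pos by (metis less_numeral_extra(3) odd_one)
  then have "n > 0" by (cases n) auto
  have trans: "aff 0 (of_int q * real n) \<in> L" for q :: int
  proof -
    have "aff (- int s) 0 + aff 0 (of_int q * real N) - aff (- int s) 0 \<in> L"
      using scale_in_L translation_H H_subset_L
      by (intro subgrp_add[OF subgrp_L] subgrp_diff[OF subgrp_L]) auto
    then show ?thesis by (simp add: aff_conj_translation sn power_int_minus field_simps)
  qed
  show ?thesis
  proof (rule L_closed)
    fix A :: real
    define a where "a = max 0 \<lceil>A\<rceil>"
    have a: "a \<ge> 0" "A \<le> of_int a" unfolding a_def by linarith+
    obtain k where k: "2 ^ k \<ge> A + of_int a * real n" "[2 ^ k = 1] (mod int n)"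
      using exists_power_two_cong_1[OF sn(2)] by blast
    then obtain q where "2 ^ k - 1 = int n * q"
      by (metis cong_iff_dvd_diff dvd_def)
    then have "of_int (2 ^ k - 1) = (of_int (int n * q) :: real)" by (simp only:)
    then have q: "2 ^ k - of_int q * real n = 1" by (simp add: algebra_simps)
    define r where "r = - of_int a * real n"
    have "of_int a * 1 \<le> of_int a * real n" using a \<open>n > 0\<close> by (intro mult_left_mono) auto
    then have r: "r \<le> - A" "A - r \<le> 2 ^ k" using a k(1) by (auto simp: r_def)
    \<comment> \<open>Adding \<open>a * n\<close> moves \<open>[-A, A]\<close> into
      \<open>[0, 2 ^ k]\<close>, where the rescaled \<open>bend\<close> is translation by
      \<open>2 ^ k\<close>; undoing the shift and subtracting \<open>q * n = 2 ^ k - 1\<close>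
      leaves translation by 1.\<close>
    define l where "l = aff 0 (of_int (- q) * real n) + aff 0 (of_int (- a) * real n) +
      (aff (int k) 0 + bend - aff (int k) 0) - aff 0 (of_int (- a) * real n)"
    have "l \<in> L" unfolding l_def
      by (intro subgrp_add[OF subgrp_L] subgrp_diff[OF subgrp_L] trans bend_in_L scale_in_L)
    moreover have "app l t = app (aff 0 1) t" if "\<bar>t\<bar> \<le> A" for t
    proof -
      define x where "x = (t - r) / 2 ^ k"
      have t: "t = r + 2 ^ k * x" by (simp add: x_def)
      have "0 \<le> x" "x \<le> 1" using that r by (auto simp: x_def)
      then have "app bend x = x + 1" by (auto simp: app_bend)
      then show ?thesis using q
        by (simp add: l_def x_def r_def[symmetric] power_int_def) (simp add: r_def x_def[symmetric] field_simps)
    qed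
    ultimately show "\<exists>l\<in>L. \<forall>t. \<bar>t\<bar> \<le> A \<longrightarrow> app l t = app (aff 0 1) t" by blast
  qed
qed

lemma aff_in_L:
  assumes "dyadic c" shows "aff e c \<in> L"
proof -
  obtain k n where c: "c = of_int k / 2 ^ n" using assms by (auto simp: dyadic_def)
  have "aff 0 (of_int k) \<in> L"
    by (rule subgrp_int_family[OF subgrp_L]) (auto simp: aff_add translation_in_L add.commute)
  then have "aff (- int n) 0 + aff 0 (of_int k) - aff (- int n) 0 \<in> L"
    by (intro subgrp_add[OF subgrp_L] subgrp_diff[OF subgrp_L] scale_in_L)
  then have "aff 0 c \<in> L"
    by (simp add: aff_conj_translation c power_int_minus field_simps)
  then have "aff 0 c + aff e 0 \<in> L" by (intro subgrp_add[OF subgrp_L] scale_in_L)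
  then show ?thesis by (simp add: aff_add)
qed

lemma pl_plus_subset_L: "pl_plus \<subseteq> L"
proof (rule pl_plus_least[OF subgrp_L])
  have kink0: "kink 0 1 \<in> L"
  proof (rule L_closed)
    fix A :: real
    define k where "k = nat \<lceil>A\<rceil>"
    have "A \<le> real k" unfolding k_def by linarith
    also have "\<dots> \<le> 2 ^ k" using of_nat_mono[OF less_imp_le[OF less_exp[of k]]] by simp
    finally have k: "A \<le> 2 ^ k" .
    \<comment> \<open>Maps the break -1 of \<open>bend\<close> to 0 and its break 0 to
      \<open>2 ^ k\<close>, which is at least \<open>A\<close>; only the kink at 0 is visible on
      \<open>[-A, A]\<close>.\<close>
    define \<alpha> where "\<alpha> = aff (int k) (2 ^ k)"
    have "dyadic (2 ^ k)" using dyadic_powi[of "int k"] by simp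
    then have "\<alpha> + bend - \<alpha> \<in> L"
      unfolding \<alpha>_def by (intro subgrp_add[OF subgrp_L] subgrp_diff[OF subgrp_L] aff_in_L bend_in_L)
    moreover have "app (\<alpha> + bend - \<alpha>) t = app (kink 0 1) t" if "\<bar>t\<bar> \<le> A" for t
    proof -
      define x where "x = t / 2 ^ k - 1"
      have t: "t = app \<alpha> x" by (simp add: x_def \<alpha>_def field_simps)
      have "x \<le> 0" "x \<le> -1 \<longleftrightarrow> t \<le> 0" using that k by (auto simp: x_def field_simps)
      then have "app \<alpha> (app bend x) = app (kink 0 1) t"
        by (auto simp: \<alpha>_def app_bend app_kink x_def field_simps)
      then show ?thesis by (simp add: t)
    qed
    ultimately show "\<exists>l\<in>L. \<forall>t. \<bar>t\<bar> \<le> A \<longrightarrow> app l t = app (kink 0 1) t" by blast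
  qed
  fix b assume "dyadic b"
  then have "aff 0 b + kink 0 1 - aff 0 b \<in> L"
    by (intro subgrp_add[OF subgrp_L] subgrp_diff[OF subgrp_L] aff_in_L kink0)
  then show "kink b 1 \<in> L" by (simp add: aff_conj_kink)
qed

section \<open>Displacement and commutators\<close>

text \<open>The commutator \<open>h\<close> of \<open>aff 0 N'\<close> and \<open>Y\<close> has
  bounded support, as both are translations near either end. It moves some point, and conjugation by
  a dyadic affine map from \<open>L\<close> stretches the displacement beyond any given
  interval.\<close>

lemma exists_displacing:
  obtains p where "p \<in> P" "app p (- A) > A"
proof -
  define N' where "N' = real N"
  have N': "N' \<ge> 1" using N_pos by (simp add: N'_def)
  define Y where "Y = bend + aff 0 N' - bend"
  have Y: "Y \<in> H" using conj_translation_H[of 1] by (simp add: Y_def N'_def)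
  have T: "aff 0 N' \<in> H" using translation_H[of 1] by (simp add: N'_def)
  define h where "h = aff 0 N' + Y - aff 0 N' - Y"
  have Y_low: "app Y t = t + N'" if "t + N' \<le> -1" for t
    using that N' by (simp add: Y_def app_uminus_bend_low app_bend)
  have Y_high: "app Y t = t + 2 * N'" if "t \<ge> 2" for t
    using that N' by (simp add: Y_def app_uminus_bend_high app_bend)
  have "app h t = t" if "\<bar>t\<bar> \<ge> 4 * N' + 2" for t
  proof (cases "t \<ge> 0")
    case True
    then have "t \<ge> 4 * N' + 2" using that by simp
    then have "app (- Y) t = t - 2 * N'" "app Y (t - 3 * N') = t - N'"
      using N' by (auto simp: app_uminus_eq_iff Y_high)
    then show ?thesis by (simp add: h_def)
  next
    case False
    then have "t \<le> - 4 * N' - 2" using that by simp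
    then have "app (- Y) t = t - N'" "app Y (t - 2 * N') = t - N'"
      using N' by (auto simp: app_uminus_eq_iff Y_low)
    then show ?thesis by (simp add: h_def)
  qed
  then have "bounded_support h" unfolding bounded_support_def by blast
  moreover have "h \<in> H"
    unfolding h_def by (intro subgrp_add[OF subgrp_H] subgrp_diff[OF subgrp_H] T Y)
  ultimately have "h \<in> P" by (simp add: P_def)
  have "h \<noteq> 0"
  proof
    assume "h = 0"
    then have "aff 0 N' + Y = Y + aff 0 N'" unfolding h_def by (simp add: diff_eq_eq)
    \<comment> \<open>At \<open>- 1 - N'\<close> commutation forces \<open>Y\<close> to send -1 to
      \<open>N' - 1\<close>, whereas it sends -1 to the image of \<open>N' - 1\<close> under
      \<open>bend\<close>, which moves every nonnegative point.\<close>
    then have "app (aff 0 N' + Y) (- 1 - N') = app (Y + aff 0 N') (- 1 - N')" by simp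
    then have "app Y (- 1) = N' - 1" by (simp add: Y_low)
    moreover have "app Y (- 1) = app bend (N' - 1)"
      by (simp add: Y_def app_uminus_bend_low)
    ultimately show False using N' by (simp add: app_bend split: if_splits)
  qed
  then obtain t0 where "app h t0 \<noteq> t0" by (metis homeo_eqI app_zero)
  then have "\<exists>p\<in>P. \<exists>t. app p t > t"
  proof (cases "app h t0 > t0")
    case False
    then have "app (- h) t0 > t0"
      using \<open>app h t0 \<noteq> t0\<close> by (metis app_app_uminus app_le_iff linorder_not_le not_less_iff_gr_or_eq)
    then show ?thesis using subgrp_uminus[OF subgrp_P \<open>h \<in> P\<close>] by blast
  qed (use \<open>h \<in> P\<close> in blast)
  then obtain p s where p: "p \<in> P" "app p s > s" by blast
  define \<epsilon> where "\<epsilon> = app p s - s"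
  have "\<epsilon> > 0" using p by (simp add: \<epsilon>_def)
  \<comment> \<open>The summand 1 leaves room for rounding \<open>j\<close> to an integer, so that
    \<alpha> maps \<open>- A\<close> and \<open>A\<close> between \<open>s\<close> and the image of
    \<open>s\<close> under \<open>p\<close>.\<close>
  then obtain k where k: "2 ^ k > (2 * A + 1) / \<epsilon>"
    using real_arch_pow[of 2 "(2 * A + 1) / \<epsilon>"] by auto
  define j where "j = \<lceil>2 ^ k * s + A\<rceil>"
  define \<alpha> where "\<alpha> = aff (- int k) (of_int j / 2 ^ k)"
  have app_\<alpha>: "app \<alpha> t = (t + of_int j) / 2 ^ k" for t
    by (simp add: \<alpha>_def power_int_minus field_simps)
  have "\<alpha> \<in> L" unfolding \<alpha>_def by (intro aff_in_L) simp
  have "2 ^ k * s + A \<le> of_int j" "of_int j < 2 ^ k * s + A + 1"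
    unfolding j_def by linarith+
  moreover have "2 * A + 1 < 2 ^ k * \<epsilon>" using k \<open>\<epsilon> > 0\<close> by (simp add: field_simps)
  ultimately have "s \<le> app \<alpha> (- A)" "app \<alpha> A < app p s"
    by (auto simp: app_\<alpha> \<epsilon>_def field_simps)
  then have "app \<alpha> A < app p (app \<alpha> (- A))"
    by (metis app_le_iff less_le_trans)
  then have "A < app (- \<alpha> + p + \<alpha>) (- A)"
    by (metis app_add app_less_iff app_uminus_app)
  moreover have "- \<alpha> + p + \<alpha> \<in> P" using \<open>\<alpha> \<in> L\<close> p(1) by (rule L_conj')
  ultimately show thesis using that by blast
qed

text \<open>The map \<open>f'\<close> is the inverse of \<open>f\<close> moved by \<open>p\<close>
  away from the support of \<open>g\<close>, so it commutes with \<open>g\<close>. Hence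
  \<open>f\<close> acts on \<open>g\<close> as \<open>q = f + f'\<close> does, a commutator of
  \<open>f\<close> and \<open>p\<close> lying in \<open>P\<close>, and \<open>g\<close> normalizes
  \<open>P\<close>.\<close>

lemma commutator_in_P:
  assumes "f \<in> pl_compact" "g \<in> pl_compact"
  shows "f + g - f - g \<in> P"
proof -
  obtain A where A: "A \<ge> 0" "\<And>t. \<bar>t\<bar> \<ge> A \<Longrightarrow> app f t = t"
    using bounded_supportE[OF bounded_support_pl_compact[OF assms(1)]] by blast
  obtain B where B: "B \<ge> A" "\<And>t. \<bar>t\<bar> \<ge> B \<Longrightarrow> app g t = t"
    using bounded_supportE[OF bounded_support_pl_compact[OF assms(2)]] by blast
  obtain p where p: "p \<in> P" "app p (- B) > B" by (rule exists_displacing)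
  have fL: "f \<in> L" and gL: "g \<in> L"
    using assms pl_plus_subset_L by (auto simp: pl_compact_def)
  define f' where "f' = p - f - p"
  have comm: "f' + g = g + f'"
  proof (rule commute_disjoint)
    fix t
    show "app f' t = t \<or> app g t = t"
    proof (cases "\<bar>t\<bar> \<ge> B")
      case False
      then have "app (- p) t \<le> - B" using p(2) by (simp add: app_uminus_le_iff)
      then have "app f (app (- p) t) = app (- p) t" using A(1) B(1) by (intro A(2)) auto
      then have "app (- f) (app (- p) t) = app (- p) t" by (simp add: app_uminus_eq_iff)
      then show ?thesis by (simp add: f'_def)
    qed (use B(2) in blast)
  qed
  define q where "q = f + f'"
  have "(f + p - f) - p \<in> P" using fL p(1) by (intro subgrp_diff[OF subgrp_P] L_conj)
  then have q: "q \<in> P" unfolding q_def f'_def by (simp only: group_normalize)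
  have "q + g - q = f + (f' + g) - f' - f" unfolding q_def by (simp only: group_normalize)
  also have "\<dots> = f + g - f" unfolding comm by (simp only: group_normalize)
  finally have "f + g - f - g = q + (g + - q - g)" by (metis (no_types) add.assoc diff_conv_add_uminus)
  moreover have "q + (g + - q - g) \<in> P"
    using q gL by (intro subgrp_add[OF subgrp_P] L_conj subgrp_uminus[OF subgrp_P])
  ultimately show ?thesis by simp
qed

end

section \<open>One-sided translations and the quotient by \<open>P\<close>\<close>

text \<open>A one-sided translation: the identity near minus infinity and \<open>t + (b - a)\<close>
  near plus infinity.\<close>

definition shear :: "real \<Rightarrow> real \<Rightarrow> line_homeo" where
  "shear a b = kink a 1 - kink b 1"

lemma shear_in_pl_plus: "dyadic a \<Longrightarrow> dyadic b \<Longrightarrow> shear a b \<in> pl_plus"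
  unfolding shear_def by (intro subgrp_diff[OF subgrp_pl_plus] kink_in_pl_plus)

lemma agree_top_shear: "agree_top (shear a b) (aff 0 (b - a))"
proof -
  have "agree_top (shear a b) (aff 1 (a - 2 powi 1 * a) - aff 1 (b - 2 powi 1 * b))"
    unfolding shear_def by (intro agree_top_diff agree_top_kink)
  moreover have "aff 1 (a - 2 powi 1 * a) - aff 1 (b - 2 powi 1 * b) = aff 0 (b - a)"
    unfolding diff_conv_add_uminus aff_uminus aff_add by (simp add: power_int_minus field_simps)
  ultimately show ?thesis by simp
qed

lemma shear_add: "shear a b + shear b c = shear a c"
  unfolding shear_def by (simp only: group_normalize)

lemma kink_conj_shear:
  assumes "c \<le> a" "c \<le> b"
  shows "kink c 1 + shear a b - kink c 1 = shear (2 * a - c) (2 * b - c)"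
proof -
  have *: "kink c 1 + kink x 1 - kink c 1 = kink (2 * x - c) 1" if "c \<le> x" for x
    unfolding kink_add_kink[OF that] by (simp only: group_normalize)
  have "kink c 1 + shear a b - kink c 1 = (kink c 1 + kink a 1 - kink c 1) - (kink c 1 + kink b 1 - kink c 1)"
    unfolding shear_def by (simp only: group_normalize)
  then show ?thesis using assms by (simp add: * shear_def)
qed

text \<open>Multiplying by \<open>w\<close> or its inverse changes the translation length at
  infinity by one step \<open>c\<close>; at length 0 the element is compactly supported and so lies
  in \<open>S\<close>.\<close>

lemma translations_subset:
  assumes S: "subgrp S" "pl_compact \<subseteq> S" and w: "w \<in> S" "w \<in> pl_plus" "agree_top w (aff 0 c)"
    and h: "h \<in> pl_plus" "agree_top h (aff 0 (of_int i * c))"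
  shows "h \<in> S"
  using h
proof (induction i arbitrary: h rule: int_induct[where k = 0])
  case base
  then show ?case using S(2) by (auto simp: pl_compact_def aff_zero)
next
  case (step1 i)
  have "agree_top (h - w) (aff 0 (of_int (i + 1) * c) - aff 0 c)"
    using step1.prems w by (intro agree_top_diff)
  also have "aff 0 (of_int (i + 1) * c) - aff 0 c = aff 0 (of_int i * c)"
    unfolding diff_conv_add_uminus aff_uminus aff_add by (simp add: algebra_simps)
  finally have "h - w \<in> S"
    using step1 w subgrp_diff[OF subgrp_pl_plus] by blast
  then have "h - w + w \<in> S" using w S(1) subgrp_add by blast
  then show ?case by simp
next
  case (step2 i)
  have "agree_top (h + w) (aff 0 (of_int (i - 1) * c) + aff 0 c)"
    using step2.prems w by (intro agree_top_add)
  also have "aff 0 (of_int (i - 1) * c) + aff 0 c = aff 0 (of_int i * c)"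
    unfolding aff_add by (simp add: algebra_simps)
  finally have "h + w \<in> S"
    using step2 w subgrp_add[OF subgrp_pl_plus] by blast
  then have "h + w - w \<in> S" using w S(1) subgrp_diff by blast
  then show ?case by simp
qed

context translation_powers
begin

text \<open>Equality of the cosets \<open>P + u\<close> and \<open>P + v\<close>. Right
  multiplication always respects it; left multiplication does so for elements of the normalizer
  \<open>L\<close>.\<close>

definition cong_P :: "line_homeo \<Rightarrow> line_homeo \<Rightarrow> bool" (infix "\<approx>\<^sub>P" 50) where
  "u \<approx>\<^sub>P v \<longleftrightarrow> u - v \<in> P"

lemma cong_P_refl [simp]: "u \<approx>\<^sub>P u"
  using subgrp_zero[OF subgrp_P] by (simp add: cong_P_def)

lemma cong_P_sym: "u \<approx>\<^sub>P v \<Longrightarrow> v \<approx>\<^sub>P u"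
  using subgrp_uminus[OF subgrp_P, of "u - v"] by (simp add: cong_P_def)

lemma cong_P_trans [trans]: 
  assumes "u \<approx>\<^sub>P v" "v \<approx>\<^sub>P w" shows "u \<approx>\<^sub>P w"
proof -
  have "u - w = (u - v) + (v - w)" by (simp only: group_normalize)
  then show ?thesis using assms subgrp_add[OF subgrp_P] by (simp only: cong_P_def)
qed

lemma cong_P_add_left:
  assumes u: "u \<in> L" shows "u + v \<approx>\<^sub>P u + w \<longleftrightarrow> v \<approx>\<^sub>P w"
proof
  assume "u + v \<approx>\<^sub>P u + w"
  then have "- u + (u + v - (u + w)) + u \<in> P" unfolding cong_P_def by (rule L_conj'[OF u])
  then show "v \<approx>\<^sub>P w" unfolding cong_P_def by (simp only: group_normalize)
next
  assume "v \<approx>\<^sub>P w"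
  then have "u + (v - w) - u \<in> P" unfolding cong_P_def by (rule L_conj[OF u])
  then show "u + v \<approx>\<^sub>P u + w" unfolding cong_P_def by (simp only: group_normalize)
qed

lemma cong_P_add_right [simp]: "v + u \<approx>\<^sub>P w + u \<longleftrightarrow> v \<approx>\<^sub>P w"
  unfolding cong_P_def by (simp only: group_normalize)

lemma cong_P_add: "u \<in> L \<Longrightarrow> u \<approx>\<^sub>P u' \<Longrightarrow> v \<approx>\<^sub>P v' \<Longrightarrow> u + v \<approx>\<^sub>P u' + v'"
  using cong_P_trans[of "u + v" "u + v'" "u' + v'"] by (simp add: cong_P_add_left)

text \<open>This is the preimage in \<open>L\<close> of the centralizer of the class of
  \<open>g\<close> in the quotient of \<open>L\<close> by \<open>P\<close>.\<close>

lemma subgrp_commuting: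
  assumes g: "g \<in> L"
  shows "subgrp {h \<in> L. g + h \<approx>\<^sub>P h + g}"
proof (rule subgrpI; clarsimp)
  show "0 \<in> L" by (rule subgrp_zero[OF subgrp_L])
  show "a + b \<in> L \<and> g + (a + b) \<approx>\<^sub>P a + b + g"
    if a: "a \<in> L" "g + a \<approx>\<^sub>P a + g" and b: "b \<in> L" "g + b \<approx>\<^sub>P b + g" for a b
  proof
    show "a + b \<in> L" using a b by (intro subgrp_add[OF subgrp_L])
    have "g + a + b \<approx>\<^sub>P a + g + b" using a by simp
    also have "a + g + b \<approx>\<^sub>P a + (b + g)" using a b by (simp add: add.assoc cong_P_add_left)
    finally show "g + (a + b) \<approx>\<^sub>P a + b + g" by (simp add: add.assoc)
  qed
  show "- a \<in> L \<and> g - a \<approx>\<^sub>P - a + g" if a: "a \<in> L" "g + a \<approx>\<^sub>P a + g" for a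
  proof
    show "- a \<in> L" using a by (intro subgrp_uminus[OF subgrp_L])
    have "a + (g - a) + a \<approx>\<^sub>P a + (- a + g) + a" using cong_P_sym[OF a(2)]
      by (simp only: group_normalize)
    then show "g - a \<approx>\<^sub>P - a + g" unfolding cong_P_add_right
      by (rule iffD1[OF cong_P_add_left[OF a(1)]])
  qed
qed

text \<open>An element of \<open>pl_plus\<close> acts on a compactly supported element like a suitable
  truncation of it, so \<open>pl_compact\<close> is central modulo \<open>P\<close>.\<close>

lemma pl_compact_central:
  assumes "u \<in> pl_plus" "k \<in> pl_compact"
  shows "u + k \<approx>\<^sub>P k + u"
proof -
  obtain A where A: "\<And>t. \<bar>t\<bar> \<ge> A \<Longrightarrow> app k t = t" "A \<ge> 0"
    using bounded_supportE[OF bounded_support_pl_compact[OF assms(2)]] by blast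
  obtain v where v: "v \<in> pl_compact" "\<forall>t\<le>A. app v t = app u t"
    using pl_plus_truncate[OF assms(1)] by blast
  have "u + k - u = v + k - v"
    using A v(2) by (intro conj_agree) (metis abs_of_nonneg linorder_le_cases order_trans)
  then have "u + k - (k + u) = v + k - v - k" by (simp only: group_normalize)
    (metis add.assoc)
  then show ?thesis using commutator_in_P[OF v(1) assms(2)] by (simp add: cong_P_def)
qed

text \<open>A common denominator makes both lengths multiples of one \<open>c\<close>. Modulo
  \<open>pl_compact\<close>, which is central modulo \<open>P\<close>, both maps are then powers of
  \<open>w\<close>, and a group that is cyclic modulo a central subgroup is abelian.\<close>

lemma translations_commute:
  assumes "g \<in> pl_plus" "agree_top g (aff 0 a)" "dyadic a"
    and "h \<in> pl_plus" "agree_top h (aff 0 b)" "dyadic b"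
  shows "g + h \<approx>\<^sub>P h + g"
proof -
  obtain k n l m where a: "a = of_int k / 2 ^ n" and b: "b = of_int l / 2 ^ m"
    using assms by (auto simp: dyadic_def)
  define c where "c = (1 / 2 ^ (n + m) :: real)"
  have a': "a = of_int (k * 2 ^ m) * c" and b': "b = of_int (l * 2 ^ n) * c"
    by (simp_all add: a b c_def power_add)
  define w where "w = shear 0 c"
  have "dyadic c" unfolding c_def dyadic_divide_numeral by simp
  then have w: "w \<in> pl_plus" unfolding w_def by (intro shear_in_pl_plus) simp_all
  have wc: "agree_top w (aff 0 c)" using agree_top_shear[of 0 c] by (simp add: w_def)
  have "w + x \<approx>\<^sub>P x + w" if "x \<in> pl_plus" "agree_top x (aff 0 (of_int i * c))" for x i
  proof -
    have "x \<in> {x \<in> L. w + x \<approx>\<^sub>P x + w}"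
      by (rule translations_subset[OF subgrp_commuting _ _ w wc that])
        (use w pl_plus_subset_L pl_compact_central in \<open>auto simp: pl_compact_def\<close>)
    then show ?thesis by simp
  qed
  from this[OF assms(1) assms(2)[unfolded a']] have gw: "g + w \<approx>\<^sub>P w + g"
    by (rule cong_P_sym)
  have "h \<in> {x \<in> L. g + x \<approx>\<^sub>P x + g}"
    by (rule translations_subset[OF subgrp_commuting _ _ w wc assms(4) assms(5)[unfolded b']])
      (use gw w assms(1) pl_plus_subset_L pl_compact_central in \<open>auto simp: pl_compact_def\<close>)
  then show ?thesis by simp
qed

text \<open>Conjugating \<open>shear a' b'\<close> by \<open>kink c 1\<close> and by
  \<open>kink d 1\<close> gives \<open>shear a b\<close> and its shift, so these two are conjugate
  by \<open>k\<close>. Both \<open>k\<close> and \<open>shear a b\<close> are one-sided translations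
  and commute modulo \<open>P\<close>. Thus a shear depends modulo \<open>P\<close> only on its
  length.\<close>

lemma shear_shift:
  assumes "dyadic a" "dyadic b" "dyadic s"
  shows "shear a b \<approx>\<^sub>P shear (a + s) (b + s)"
proof -
  \<comment> \<open>So far to the left that \<open>c\<close> and \<open>d = c - s\<close> lie below
    \<open>a'\<close> and \<open>b'\<close>, as the conjugation formula needs.\<close>
  define c :: real where "c = - of_int \<lceil>\<bar>a\<bar> + \<bar>b\<bar> + 2 * \<bar>s\<bar>\<rceil>"
  have "\<bar>a\<bar> + \<bar>b\<bar> + 2 * \<bar>s\<bar> \<le> - c" unfolding c_def by linarith
  then have c: "c \<le> a" "c \<le> b" "c \<le> a + 2 * s" "c \<le> b + 2 * s" by linarith+
  have "dyadic c" unfolding c_def by simp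
  define d where "d = c - s"
  have d: "dyadic d" unfolding d_def using \<open>dyadic c\<close> assms by blast
  define a' b' where "a' = (a + c) / 2" and "b' = (b + c) / 2"
  have ab: "c \<le> a'" "c \<le> b'" "2 * a' - c = a" "2 * b' - c = b"
    "d \<le> a'" "d \<le> b'" "2 * a' - d = a + s" "2 * b' - d = b + s"
    using c by (auto simp: a'_def b'_def d_def field_simps)
  define k where "k = shear d c"
  have k: "k \<in> pl_plus" unfolding k_def using \<open>dyadic c\<close> d by (intro shear_in_pl_plus)
  have 1: "kink c 1 + shear a' b' - kink c 1 = shear a b"
    using kink_conj_shear[of c a' b'] ab by simp
  have 2: "kink d 1 + shear a' b' - kink d 1 = shear (a + s) (b + s)"
    using kink_conj_shear[of d a' b'] ab by simp
  have 3: "shear (a + s) (b + s) + k = k + shear a b"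
    unfolding 1[symmetric] 2[symmetric] k_def shear_def[of d c] by (simp only: group_normalize)
  have "shear a b + k \<approx>\<^sub>P k + shear a b"
    using assms d \<open>dyadic c\<close> k unfolding k_def
    by (intro translations_commute[OF _ agree_top_shear _ _ agree_top_shear] shear_in_pl_plus) auto
  then have "shear a b + k \<approx>\<^sub>P shear (a + s) (b + s) + k" unfolding 3 .
  then show ?thesis by simp
qed

text \<open>Moving \<open>kink 0 1\<close> past a shear doubles its length \<open>u\<close>, and
  \<open>kink b 1\<close> is \<open>shear b 0 + kink 0 1\<close>, which contributes the length
  \<open>- b\<close>; modulo \<open>P\<close> only lengths matter.\<close>

lemma normal_form_step:
  assumes "dyadic b" "dyadic u"
  shows "kink b 1 + (shear 0 u + kink 0 e) \<approx>\<^sub>P shear 0 (2 * u - b) + kink 0 (e + 1)"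
proof -
  have shear_in_L: "shear x y \<in> L" if "dyadic x" "dyadic y" for x y
    using shear_in_pl_plus[OF that] pl_plus_subset_L by blast
  have kink_in_L: "kink 0 1 \<in> L"
    using kink_in_pl_plus[of 0 1] pl_plus_subset_L by auto
  \<comment> \<open>Shifting by this amount makes both centres nonnegative, so that
    \<open>kink 0 1\<close> simply doubles them.\<close>
  define c where "c = \<bar>u\<bar>"
  have c: "dyadic c" using assms by (simp add: c_def abs_if)
  have "kink 0 1 + shear 0 u \<approx>\<^sub>P kink 0 1 + shear c (c + u)"
    using shear_shift[of 0 u c] assms c by (simp add: cong_P_add_left[OF kink_in_L] add.commute)
  also have "kink 0 1 + shear c (c + u) = shear (2 * c) (2 * (c + u)) + kink 0 1"
    using kink_conj_shear[of 0 c "c + u"] by (simp add: c_def diff_eq_eq)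
  also have "\<dots> \<approx>\<^sub>P shear (- b) (2 * u - b) + kink 0 1"
    using shear_shift[of "2 * c" "2 * (c + u)" "- 2 * c - b"] assms c
    by (simp add: dyadic_mult dyadic_add dyadic_diff algebra_simps)
  finally have 1: "kink 0 1 + shear 0 u \<approx>\<^sub>P shear (- b) (2 * u - b) + kink 0 1" .
  have "kink b 1 + shear 0 u = shear b 0 + (kink 0 1 + shear 0 u)"
    unfolding shear_def by (simp only: group_normalize)
  also have "\<dots> \<approx>\<^sub>P shear 0 (- b) + (shear (- b) (2 * u - b) + kink 0 1)"
    using shear_shift[of b 0 "- b"] assms by (intro cong_P_add[OF _ _ 1] shear_in_L) auto
  also have "\<dots> = shear 0 (2 * u - b) + kink 0 1"
    by (simp add: shear_add flip: add.assoc)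
  finally have "kink b 1 + shear 0 u + kink 0 e \<approx>\<^sub>P shear 0 (2 * u - b) + kink 0 1 + kink 0 e"
    by simp
  then show ?thesis by (simp add: add.assoc kink_add add.commute[of e])
qed

text \<open>Factors are absorbed one at a time, their exponents changing in steps of one. The form
  is useful because \<open>u\<close> and \<open>e\<close> can be read off the germ at plus
  infinity.\<close>

lemma normal_form:
  assumes "f \<in> pl_plus"
  shows "\<exists>u e. dyadic u \<and> f \<approx>\<^sub>P shear 0 u + kink 0 e"
  using assms
proof (induction rule: pl_plus.induct)
  case pl_plus_0
  show ?case
    by (intro exI[of _ 0]) (simp add: shear_def kink_zero)
next
  case (pl_plus_step g b i)
  have inL: "kink b e \<in> L" for e
    using kink_in_pl_plus[OF pl_plus_step(2)] pl_plus_subset_L by blast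
  show ?case
  proof (induction i rule: int_induct[where k = 0])
    case base
    then show ?case using pl_plus_step by (simp add: kink_zero)
  next
    case (step1 i)
    then obtain u e where u: "dyadic u" "kink b i + g \<approx>\<^sub>P shear 0 u + kink 0 e" by blast
    have "kink b (i + 1) + g = kink b 1 + (kink b i + g)"
      by (simp add: kink_add add.commute flip: add.assoc)
    also have "\<dots> \<approx>\<^sub>P kink b 1 + (shear 0 u + kink 0 e)" using u inL by (simp add: cong_P_add_left)
    also have "\<dots> \<approx>\<^sub>P shear 0 (2 * u - b) + kink 0 (e + 1)"
      using u pl_plus_step by (intro normal_form_step)
    finally have "kink b (i + 1) + g \<approx>\<^sub>P shear 0 (2 * u - b) + kink 0 (e + 1)" .
    moreover have "dyadic (2 * u - b)"
      using u pl_plus_step by (intro dyadic_diff dyadic_mult dyadic_numeral)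
    ultimately show ?case by blast
  next
    case (step2 i)
    then obtain u e where u: "dyadic u" "kink b i + g \<approx>\<^sub>P shear 0 u + kink 0 e" by blast
    \<comment> \<open>Solves \<open>2 * v - b = u\<close>, which runs the step formula backwards;
      \<open>kink b 1\<close> is then cancelled on the left.\<close>
    define v where "v = (u + b) / 2"
    have "dyadic (u + b)" using u(1) pl_plus_step by (intro dyadic_add)
    then have v: "dyadic v" "2 * v - b = u"
      using dyadic_divide_numeral[of "u + b" 1] by (simp_all add: v_def field_simps)
    have "kink b 1 + (kink b (i - 1) + g) = kink b i + g"
      by (simp add: kink_add flip: add.assoc)
    also have "\<dots> \<approx>\<^sub>P shear 0 (2 * v - b) + kink 0 (e - 1 + 1)" using u v by simp
    also have "\<dots> \<approx>\<^sub>P kink b 1 + (shear 0 v + kink 0 (e - 1))"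
      using v pl_plus_step by (intro cong_P_sym[OF normal_form_step])
    finally have "kink b (i - 1) + g \<approx>\<^sub>P shear 0 v + kink 0 (e - 1)"
      using inL by (simp add: cong_P_add_left)
    with v show ?case by blast
  qed
qed

text \<open>Elements of \<open>P\<close> are trivial near plus infinity, so the normal form has the
  germ of \<open>f\<close> there, which is trivial. This forces \<open>u = 0\<close> and
  \<open>e = 0\<close>, whence \<open>f\<close> itself is in \<open>P\<close>.\<close>

theorem pl_compact_subset_H: "pl_compact \<subseteq> H"
proof
  fix f assume f: "f \<in> pl_compact"
  then obtain u e where u: "f \<approx>\<^sub>P shear 0 u + kink 0 e"
    using normal_form unfolding pl_compact_def by blast
  define x where "x = shear 0 u + kink 0 e"
  have "agree_top x (aff 0 (u - 0) + aff e (0 - 2 powi e * 0))"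
    unfolding x_def by (intro agree_top_add agree_top_shear agree_top_kink)
  then have x: "agree_top x (aff e u)" by (simp add: aff_add)
  have "agree_top (f - x) 0"
    using u bounded_support_agree_top by (simp add: cong_P_def P_def x_def)
  from agree_top_add[OF this agree_top_refl[of x]] have "agree_top f x" by simp
  then have "agree_top (aff e u) (aff 0 0)"
    using x f by (metis aff_zero agree_top_sym agree_top_trans mem_Collect_eq pl_compact_def)
  then have "e = 0" "u = 0" using agree_top_aff_cong by blast+
  then have "x = 0" by (simp add: x_def shear_def kink_zero)
  then show "f \<in> H" using u by (simp add: cong_P_def P_def x_def[symmetric])
qed

end

section \<open>Piecewise linear interpolation and breakpoints\<close>

text \<open>Induction over the pieces. The slope beyond \<open>a k\<close> is left free, so the
  induction hypothesis can already supply the slope of the next piece, and one kink at the image of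
  the new endpoint sets the slope after it.\<close>

lemma pl_plus_interpolate:
  fixes f :: "real \<Rightarrow> real" and a :: "nat \<Rightarrow> real"
  assumes inc: "\<And>i. i < k \<Longrightarrow> a i < a (Suc i)" and dy: "\<And>i. i \<le> k \<Longrightarrow> dyadic (a i)"
    and aff: "\<And>i. i < k \<Longrightarrow> \<exists>(e::int) c. \<forall>x\<in>{a i..a (Suc i)}. f x = 2 powi e * x + c"
    and start: "f (a 0) = a 0"
  shows "\<exists>g\<in>pl_plus. (\<forall>t\<le>a 0. app g t = t) \<and> (\<forall>t\<in>{a 0..a k}. app g t = f t) \<and>
    (\<forall>t\<ge>a k. app g t = f (a k) + 2 powi e * (t - a k))"
  using inc dy aff
proof (induction k arbitrary: e)
  case 0
  show ?case
    by (rule bexI[of _ "kink (a 0) e"]) (use dy[of 0] in \<open>auto simp: start app_kink_ge kink_in_pl_plus\<close>)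
next
  case (Suc k)
  then obtain e0 c where c: "\<And>x. x \<in> {a k..a (Suc k)} \<Longrightarrow> f x = 2 powi e0 * x + c"
    by (meson lessI)
  obtain g where g: "g \<in> pl_plus" "\<forall>t\<le>a 0. app g t = t" "\<forall>t\<in>{a 0..a k}. app g t = f t"
    "\<forall>t\<ge>a k. app g t = f (a k) + 2 powi e0 * (t - a k)"
    using Suc.IH[of e0] Suc.prems by auto
  have less: "a k < a (Suc k)" using Suc.prems by simp
  have "a 0 \<le> a i" if "i \<le> Suc k" for i
    using that
  proof (induction i)
    case (Suc i)
    then show ?case using Suc.prems \<open>\<And>i. i < Suc k \<Longrightarrow> a i < a (Suc i)\<close>[of i] by simp
  qed simp
  then have a0: "a 0 \<le> a (Suc k)" by simp
  have gk: "app g t = f t" if "t \<in> {a k..a (Suc k)}" for t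
    using that g(4) c less by (auto simp: algebra_simps)
  define b where "b = app g (a (Suc k))"
  have b: "b = f (a (Suc k))" using gk less by (simp add: b_def)
  have "dyadic b" unfolding b_def using Suc.prems g by (intro pl_plus_dyadic) auto
  define h where "h = kink b (e - e0) + g"
  have "h \<in> pl_plus" unfolding h_def using g \<open>dyadic b\<close> by (intro pl_plus_step)
  have hg: "app h t = app g t" if "t \<le> a (Suc k)" for t
    using that by (simp add: h_def b_def)
  have "app h t = t" if "t \<le> a 0" for t
    using that a0 g hg by auto
  moreover have "app h t = f t" if "t \<in> {a 0..a (Suc k)}" for t
    using that hg[of t] g(3) gk[of t] by (cases "t \<le> a k") auto
  moreover have "app h t = f (a (Suc k)) + 2 powi e * (t - a (Suc k))" if t: "t \<ge> a (Suc k)" for t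
  proof -
    have "app g t - b = 2 powi e0 * (t - a (Suc k))"
      using t less g(4)[rule_format, of t] g(4)[rule_format, of "a (Suc k)"]
      by (simp add: b_def algebra_simps)
    moreover have "b \<le> app g t" using t by (simp add: b_def)
    moreover have "(2::real) powi (e - e0) * 2 powi e0 = 2 powi e"
      by (simp flip: power_int_add)
    ultimately show ?thesis
      by (simp add: h_def app_kink_ge b flip: mult.assoc)
  qed
  ultimately show ?case using \<open>h \<in> pl_plus\<close> by blast
qed

text \<open>Multiplying by a kink on the left adds at most one break, the preimage of its centre
  under the old map.\<close>

lemma pl_plus_finite_breaks:
  assumes "f \<in> pl_plus"
  shows "\<exists>S. finite S \<and> (\<forall>s\<in>S. dyadic s) \<and>
    (\<forall>u v. u < v \<longrightarrow> {u<..<v} \<inter> S = {} \<longrightarrow>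
      (\<exists>(e::int) c. \<forall>t\<in>{u..v}. app f t = 2 powi e * t + c))"
  using assms
proof (induction rule: pl_plus.induct)
  case pl_plus_0
  have "\<exists>(e::int) c. \<forall>t\<in>{u..v}. app 0 t = 2 powi e * t + c" for u v :: real
    by (rule exI[of _ 0], rule exI[of _ 0]) simp
  then show ?case by (intro exI[of _ "{}"]) simp
next
  case (pl_plus_step g b i)
  then obtain S where S: "finite S" "\<forall>s\<in>S. dyadic s" and
    aff: "\<And>u v. u < v \<Longrightarrow> {u<..<v} \<inter> S = {} \<Longrightarrow>
      \<exists>(e::int) c. \<forall>t\<in>{u..v}. app g t = 2 powi e * t + c" by blast
  define s where "s = app (- g) b"
  have gs: "app g s = b" by (simp add: s_def)
  have "dyadic s" unfolding s_def
    using pl_plus_step subgrp_uminus[OF subgrp_pl_plus] by (intro pl_plus_dyadic)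
  have "\<exists>(e::int) c. \<forall>t\<in>{u..v}. app (kink b i + g) t = 2 powi e * t + c"
    if uv: "u < v" "{u<..<v} \<inter> insert s S = {}" for u v
  proof -
    obtain e c where e: "\<forall>t\<in>{u..v}. app g t = 2 powi e * t + c"
      using aff[of u v] uv by auto
    have "v \<le> s \<or> s \<le> u" using uv by auto
    then show ?thesis
    proof
      assume "v \<le> s"
      then have "app g t \<le> b" if "t \<in> {u..v}" for t
        using that by (simp flip: gs)
      then show ?thesis using e by (intro exI[of _ e] exI[of _ c]) simp
    next
      assume "s \<le> u"
      then have "b \<le> app g t" if "t \<in> {u..v}" for t
        using that by (simp flip: gs)
      then have "\<forall>t\<in>{u..v}. app (kink b i + g) t = 2 powi (i + e) * t + (b + 2 powi i * (c - b))"
        using e by (auto simp: app_kink_ge power_int_add algebra_simps)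
      then show ?thesis by blast
    qed
  qed
  then show ?case using S \<open>dyadic s\<close> by (intro exI[of _ "insert s S"]) auto
qed

section \<open>Thompson's group\<close>

definition F_homeo :: "line_homeo set" where
  "F_homeo = {g \<in> pl_plus. \<forall>t. t \<notin> {0..1} \<longrightarrow> app g t = t}"

text \<open>If an endpoint moved, its image or its preimage would lie outside the interval without
  being fixed, by injectivity.\<close>

lemma F_homeo_fix: 
  assumes "g \<in> F_homeo" "t \<le> 0 \<or> t \<ge> 1" shows "app g t = t"
proof -
  have fix_out: "app g s = s" if "s < 0 \<or> s > 1" for s
    using that assms(1) by (auto simp: F_homeo_def)
  have "\<not> app g 0 < 0" "\<not> app g 0 > 0" "\<not> app g 1 < 1" "\<not> app g 1 > 1"
  proof -
    show "\<not> app g 0 < 0"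
    proof
      assume "app g 0 < 0"
      then have "app g (app g 0 ) = app g 0" by (intro fix_out) simp
      then show False using \<open>app g 0 < 0\<close> by simp
    qed
    show "\<not> app g 1 > 1"
    proof
      assume "app g 1 > 1"
      then have "app g (app g 1) = app g 1" by (intro fix_out) simp
      then show False using \<open>app g 1 > 1\<close> by simp
    qed
    show "\<not> app g 0 > 0"
    proof
      assume "app g 0 > 0"
      then have "app (- g) 0 < 0" by (metis app_app_uminus app_less_iff)
      then have "app g (app (- g) 0) = app (- g) 0" by (intro fix_out) simp
      then show False using \<open>app (- g) 0 < 0\<close> by simp
    qed
    show "\<not> app g 1 < 1"
    proof
      assume "app g 1 < 1"
      then have "app (- g) 1 > 1" by (metis app_app_uminus app_less_iff)
      then have "app g (app (- g) 1) = app (- g) 1" by (intro fix_out) simp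
      then show False using \<open>app (- g) 1 > 1\<close> by simp
    qed
  qed
  then have "app g 0 = 0" "app g 1 = 1" by linarith+
  then show ?thesis using fix_out[of t] assms(2) by (cases "t = 0 \<or> t = 1") auto
qed

lemma F_homeo_image:
  assumes "g \<in> F_homeo" shows "app g ` {0..1} = {0..1}"
proof -
  have "app g 0 = 0" "app g 1 = 1" using F_homeo_fix[OF assms] by auto
  then have *: "app g t \<in> {0..1} \<longleftrightarrow> t \<in> {0..1}" for t
    by (metis app_le_iff atLeastAtMost_iff)
  show ?thesis
  proof
    show "app g ` {0..1} \<subseteq> {0..1}" using * by blast
    show "{0..1} \<subseteq> app g ` {0..1}"
    proof
      fix t :: real assume "t \<in> {0..1}"
      then have "app (- g) t \<in> {0..1}" using *[of "app (- g) t"] by simp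
      then show "t \<in> app g ` {0..1}" by (metis app_app_uminus image_eqI)
    qed
  qed
qed

lemma subgrp_F_homeo: "subgrp F_homeo"
proof (rule subgrpI)
  show "0 \<in> F_homeo" by (simp add: F_homeo_def pl_plus_0)
  show "a + b \<in> F_homeo" if "a \<in> F_homeo" "b \<in> F_homeo" for a b
    using that subgrp_add[OF subgrp_pl_plus] by (auto simp: F_homeo_def)
  show "- a \<in> F_homeo" if "a \<in> F_homeo" for a
    using that subgrp_uminus[OF subgrp_pl_plus] by (auto simp: F_homeo_def app_uminus_eq_iff)
qed

lemma app_continuous: "continuous_on A (app g)"
proof -
  have "continuous_on UNIV (app g)"
    by (rule continuous_onI_mono) (use app_surj in auto)
  then show ?thesis by (rule continuous_on_subset) simp
qed

lemma thompson_F_elem_app: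
  assumes "g \<in> F_homeo" shows "thompson_F_elem (app g)"
  unfolding thompson_F_elem_def
proof (intro conjI)
  have "homeomorphism {0..1} {0..1} (app g) (app (- g))"
    unfolding homeomorphism_def
    using F_homeo_image assms subgrp_uminus[OF subgrp_F_homeo] app_continuous by simp
  then show "\<exists>h. homeomorphism {0..1} {0..1} (app g) h" by blast
  show "\<forall>x. x \<notin> {0..1} \<longrightarrow> app g x = x" using assms by (simp add: F_homeo_def)
  obtain S where S: "finite S" "\<forall>s\<in>S. dyadic s" and
    aff: "\<And>u v. u < v \<Longrightarrow> {u<..<v} \<inter> S = {} \<Longrightarrow>
      \<exists>(e::int) c. \<forall>t\<in>{u..v}. app g t = 2 powi e * t + c"
    using pl_plus_finite_breaks[of g] assms unfolding F_homeo_def by blast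
  define B where "B = insert 0 (insert 1 (S \<inter> {0..1}))"
  define xs where "xs = sorted_list_of_set B"
  have "finite B" using S by (simp add: B_def)
  then have set_xs: "set xs = B" and sorted: "sorted_wrt (<) xs"
    by (simp_all add: xs_def strict_sorted_list_of_set)
  have len: "length xs > 0" using set_xs by (cases xs) (auto simp: B_def)
  define k where "k = length xs - 1"
  have less: "xs ! i < xs ! j" if "i < j" "j < length xs" for i j
    using sorted that by (simp add: sorted_wrt_iff_nth_less)
  have le: "xs ! i \<le> xs ! j" if "i \<le> j" "j < length xs" for i j
    using less[of i j] that by (cases "i = j") auto
  have B01: "b \<in> {0..1}" if "b \<in> B" for b using that by (auto simp: B_def)
  have mem: "xs ! i \<in> B" if "i < length xs" for i using that set_xs by auto
  obtain i where i: "i < length xs" "xs ! i = 0"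
    using set_xs by (metis B_def in_set_conv_nth insertI1)
  obtain j where j: "j < length xs" "xs ! j = 1"
    using set_xs by (metis B_def in_set_conv_nth insertI1 insertI2)
  have "xs ! 0 = 0" using le[of 0 i] i B01[OF mem[OF len]] by auto
  moreover have "xs ! k = 1"
    using le[of j k] j B01[OF mem[of k]] len by (auto simp: k_def)
  moreover have "xs ! i < xs ! Suc i" if "i < k" for i using that less by (simp add: k_def)
  moreover have "dyadic (xs ! i)" if "i \<le> k" for i
  proof -
    have "i < length xs" using that len unfolding k_def by linarith
    then have "xs ! i \<in> B" by (rule mem)
    then show ?thesis using S by (auto simp: B_def)
  qed
  moreover have "\<exists>(e::int) c. \<forall>x\<in>{xs ! i..xs ! Suc i}. app g x = 2 powi e * x + c" if "i < k" for i
  proof (rule aff)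
    have i: "Suc i < length xs" using that by (simp add: k_def)
    show "xs ! i < xs ! Suc i" using i less by simp
    show "{xs ! i<..<xs ! Suc i} \<inter> S = {}"
    proof (rule ccontr)
      assume "{xs ! i<..<xs ! Suc i} \<inter> S \<noteq> {}"
      then obtain s where s: "xs ! i < s" "s < xs ! Suc i" "s \<in> S" by auto
      then have "s \<in> B"
        using B01[OF mem[of i]] B01[OF mem[of "Suc i"]] i by (auto simp: B_def)
      then obtain l where "l < length xs" "xs ! l = s" using set_xs by (metis in_set_conv_nth)
      then show False using s le[of l i] le[of "Suc i" l] i by (cases "l \<le> i") auto
    qed
  qed
  ultimately show "\<exists>(k::nat) a. a 0 = 0 \<and> a k = 1 \<and> (\<forall>i<k. a i < a (Suc i)) \<and>
      (\<forall>i\<le>k. dyadic (a i)) \<and>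
      (\<forall>i<k. \<exists>(e::int) c. \<forall>x\<in>{a i..a (Suc i)}. app g x = 2 powi e * x + c)"
    by (intro exI[of _ k] exI[of _ "(!) xs"]) blast
qed

text \<open>It is not known at first that \<open>f 0 = 0\<close>, so the interpolation is applied to
  \<open>f x - f 0\<close>. The resulting \<open>g\<close> shows that \<open>f\<close> is increasing
  on the interval, and then surjectivity fixes both endpoints.\<close>

lemma thompson_F_elem_imp_app:
  assumes "thompson_F_elem f" shows "\<exists>g\<in>F_homeo. f = app g"
proof -
  obtain f' k a where hom: "homeomorphism {0..1} {0..1} f f'"
    and out: "\<And>x. x \<notin> {0..1} \<Longrightarrow> f x = x"
    and a: "a 0 = 0" "a k = 1" "\<And>i. i < k \<Longrightarrow> a i < a (Suc i)" "\<And>i. i \<le> k \<Longrightarrow> dyadic (a i)"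
    and aff: "\<And>i. i < k \<Longrightarrow> \<exists>(e::int) c. \<forall>x\<in>{a i..a (Suc i)}. f x = 2 powi e * x + c"
    using assms unfolding thompson_F_elem_def by blast
  have aff': "\<exists>(e::int) c. \<forall>x\<in>{a i..a (Suc i)}. f x - f 0 = 2 powi e * x + c" if i: "i < k" for i
  proof -
    obtain e c where "\<forall>x\<in>{a i..a (Suc i)}. f x = 2 powi e * x + c" using aff[OF i] by blast
    then have "\<forall>x\<in>{a i..a (Suc i)}. f x - f 0 = 2 powi e * x + (c - f 0)" by simp
    then show ?thesis by blast
  qed
  obtain g where g: "g \<in> pl_plus" "\<forall>t\<le>a 0. app g t = t"
    "\<forall>t\<in>{a 0..a k}. app g t = f t - f 0"
    "\<forall>t\<ge>a k. app g t = f (a k) - f 0 + 2 powi 0 * (t - a k)"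
    using pl_plus_interpolate[of k a "\<lambda>x. f x - f 0" 0] a aff' by auto
  have img: "f ` {0..1} = {0..1}" using hom by (simp add: homeomorphism_def)
  have mono: "f s \<le> f t" if "s \<in> {0..1}" "t \<in> {0..1}" "s \<le> t" for s t
    using that g(3) a app_le_iff[of g s t] by auto
  have "0 \<in> f ` {0..1}" "1 \<in> f ` {0..1}" unfolding img by auto
  then obtain s t where st: "s \<in> {0..1}" "f s = 0" "t \<in> {0..1}" "f t = 1"
    by (elim imageE) metis
  have "f 0 \<in> f ` {0..1}" "f 1 \<in> f ` {0..1}" by (intro imageI; simp)+
  then have "f 0 \<in> {0..1}" "f 1 \<in> {0..1}" unfolding img by this+
  then have f01: "f 0 = 0" "f 1 = 1" using mono[of 0 s] mono[of t 1] st by auto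
  have "app g t = f t" for t
  proof (cases "t \<in> {0..1}")
    case True
    then show ?thesis using g(3) a f01 by simp
  next
    case False
    then show ?thesis using g a f01 out[OF False] by (cases "t \<le> 0") auto
  qed
  then have "f = app g" by auto
  moreover have "g \<in> F_homeo" using g(1) out \<open>f = app g\<close> by (simp add: F_homeo_def)
  ultimately show ?thesis by blast
qed

lemma carrier_thompson_F: "carrier thompson_F = app ` F_homeo"
  using thompson_F_elem_app thompson_F_elem_imp_app by (auto simp: thompson_F_def)

lemma app_comp: "app f \<circ> app g = app (f + g)"
  by (simp add: fun_eq_iff)

lemma mult_thompson_F: "f \<otimes>\<^bsub>thompson_F\<^esub> g = f \<circ> g"
  by (simp add: thompson_F_def)

lemma one_thompson_F: "\<one>\<^bsub>thompson_F\<^esub> = app 0"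
  by (simp add: thompson_F_def fun_eq_iff)

lemma group_thompson_F: "group thompson_F"
proof (rule groupI)
  show "\<one>\<^bsub>thompson_F\<^esub> \<in> carrier thompson_F"
    by (simp add: carrier_thompson_F one_thompson_F subgrp_zero[OF subgrp_F_homeo])
  fix x y z
  assume x: "x \<in> carrier thompson_F"
  then obtain f where f: "f \<in> F_homeo" "x = app f" by (auto simp: carrier_thompson_F)
  then have "app (- f) \<in> carrier thompson_F"
    by (simp add: carrier_thompson_F subgrp_uminus[OF subgrp_F_homeo])
  moreover have "app (- f) \<otimes>\<^bsub>thompson_F\<^esub> x = \<one>\<^bsub>thompson_F\<^esub>"
    by (simp add: mult_thompson_F one_thompson_F f app_comp)
  ultimately show "\<exists>y\<in>carrier thompson_F. y \<otimes>\<^bsub>thompson_F\<^esub> x = \<one>\<^bsub>thompson_F\<^esub>" by blast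
  show "\<one>\<^bsub>thompson_F\<^esub> \<otimes>\<^bsub>thompson_F\<^esub> x = x"
    by (simp add: mult_thompson_F one_thompson_F f app_comp)
  assume "y \<in> carrier thompson_F"
  then show "x \<otimes>\<^bsub>thompson_F\<^esub> y \<in> carrier thompson_F"
    using f subgrp_add[OF subgrp_F_homeo] by (auto simp: mult_thompson_F carrier_thompson_F app_comp)
  show "x \<otimes>\<^bsub>thompson_F\<^esub> y \<otimes>\<^bsub>thompson_F\<^esub> z = x \<otimes>\<^bsub>thompson_F\<^esub> (y \<otimes>\<^bsub>thompson_F\<^esub> z)"
    by (simp add: mult_thompson_F comp_assoc)
qed

lemma inv_thompson_F:
  assumes "g \<in> F_homeo" shows "inv\<^bsub>thompson_F\<^esub> (app g) = app (- g)"
proof (rule group.inv_equality[OF group_thompson_F])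
  show "app (- g) \<otimes>\<^bsub>thompson_F\<^esub> app g = \<one>\<^bsub>thompson_F\<^esub>"
    by (simp add: mult_thompson_F one_thompson_F app_comp)
qed (use assms subgrp_uminus[OF subgrp_F_homeo] in \<open>auto simp: carrier_thompson_F\<close>)

section \<open>Passing from the unit interval to the line\<close>

text \<open>The piecewise linear interpolation of \<open>2 powr (t - 1)\<close> at the integers, so
  that adding 1 to \<open>t\<close> still doubles the value.\<close>

definition pl_exp :: "real \<Rightarrow> real" where
  "pl_exp t = 2 powi (\<lfloor>t\<rfloor> - 1) * (1 + frac t)"

text \<open>Symmetric about its value 1/2 at 0. A unit translation of the line becomes doubling near
  0 and halving of the distance to 1 near 1.\<close>

definition line_to_unit :: "real \<Rightarrow> real" where
  "line_to_unit t = (if t \<le> 0 then pl_exp t else 1 - pl_exp (- t))"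

lemma pl_exp_add_int: "pl_exp (t + of_int i) = 2 powi i * pl_exp t"
proof -
  have "(2::real) powi (\<lfloor>t\<rfloor> + i - 1) = 2 powi i * 2 powi (\<lfloor>t\<rfloor> - 1)"
    by (simp add: algebra_simps flip: power_int_add)
  moreover have "frac (t + of_int i) = frac t" by (simp add: frac_def)
  ultimately show ?thesis by (simp add: pl_exp_def)
qed

lemma pl_exp_unit:
  assumes "0 \<le> t" "t \<le> 1" shows "pl_exp t = (1 + t) / 2"
proof (cases "t = 1")
  case False
  then have "\<lfloor>t\<rfloor> = 0" using assms by (simp add: floor_eq_iff)
  then show ?thesis by (simp add: pl_exp_def frac_def power_int_minus)
qed (simp add: pl_exp_def)

lemma line_to_unit_add_low:
  assumes "t \<le> -1" shows "line_to_unit (t + 1) = 2 * line_to_unit t"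
  using assms pl_exp_add_int[of t 1] by (simp add: line_to_unit_def)

lemma line_to_unit_mid:
  assumes "-1 \<le> t" "t \<le> 1" shows "line_to_unit t = (t + 2) / 4"
proof (cases "t \<le> 0")
  case True
  then show ?thesis
    using assms pl_exp_add_int[of t 1] pl_exp_unit[of "t + 1"] by (simp add: line_to_unit_def)
next
  case False
  then show ?thesis
    using assms pl_exp_add_int[of "- t" 1] pl_exp_unit[of "- t + 1"]
    by (simp add: line_to_unit_def field_simps)
qed

lemma line_to_unit_add_high:
  assumes "t \<ge> 0" shows "line_to_unit (t + 1) = (1 + line_to_unit t) / 2"
proof (cases "t = 0")
  case True
  then show ?thesis by (simp add: line_to_unit_mid)
next
  case False
  then show ?thesis
    using assms pl_exp_add_int[of "- 1 - t" 1] by (simp add: line_to_unit_def field_simps)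
qed

lemma line_to_unit_affine:
  fixes i :: int
  shows "\<exists>(e::int) c. \<forall>t\<in>{of_int i..of_int i + 1}. line_to_unit t = 2 powi e * t + c"
proof -
  have low: "pl_exp t = 2 powi (j - 1) * t + 2 powi (j - 1) * (1 - of_int j)"
    if "of_int j \<le> t" "t \<le> of_int j + 1" for t :: real and j :: int
  proof -
    have "pl_exp t = 2 powi j * ((1 + (t - of_int j)) / 2)"
      using that pl_exp_add_int[of "t - of_int j" j] pl_exp_unit[of "t - of_int j"] by simp
    moreover have "(2::real) powi j = 2 * 2 powi (j - 1)"
      using power_int_add[of "2::real" 1 "j - 1"] by simp
    ultimately show ?thesis by (simp add: algebra_simps)
  qed
  show ?thesis
  proof (cases "i < 0")
    case True
    then have "of_int i + 1 \<le> (0::real)" by linarith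
    then have "\<forall>t\<in>{of_int i..of_int i + 1}. line_to_unit t =
        2 powi (i - 1) * t + 2 powi (i - 1) * (1 - of_int i)"
      using low[of i] by (auto simp: line_to_unit_def)
    then show ?thesis by blast
  next
    case False
    have "line_to_unit t = 2 powi (- i - 2) * t + (1 - 2 powi (- i - 2) * (2 + of_int i))"
      if t: "t \<in> {of_int i..of_int i + 1}" for t :: real
    proof -
      have "line_to_unit t = 1 - pl_exp (- t)"
      proof (cases "t = 0")
        case True
        then show ?thesis by (simp add: line_to_unit_def pl_exp_unit)
      next
        assume "t \<noteq> 0"
        then show ?thesis using t False by (auto simp: line_to_unit_def)
      qed
      also have "pl_exp (- t) = 2 powi (- i - 1 - 1) * (- t) + 2 powi (- i - 1 - 1) * (1 - of_int (- i - 1))"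
        using t by (intro low) auto
      finally show ?thesis by (simp add: algebra_simps)
    qed
    then show ?thesis by blast
  qed
qed

lemma line_to_unit_nat:
  "line_to_unit (- real n) = 1 / 2 ^ Suc n" "line_to_unit (real n) = 1 - 1 / 2 ^ Suc n"
proof -
  have *: "pl_exp (- real n) = 1 / 2 ^ Suc n"
    using pl_exp_add_int[of 0 "- int n"] pl_exp_unit[of 0] by (simp add: power_int_minus field_simps)
  then show "line_to_unit (- real n) = 1 / 2 ^ Suc n" by (simp add: line_to_unit_def)
  show "line_to_unit (real n) = 1 - 1 / 2 ^ Suc n"
    using * by (cases "n = 0") (auto simp: line_to_unit_def)
qed

text \<open>On bounded intervals \<open>line_to_unit\<close> coincides with a dyadic map of the
  whole line, which yields its monotonicity, its surjectivity onto the open interval and piecewise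
  linearity of conjugates.\<close>

lemma line_to_unit_interpolate:
  obtains c g where "dyadic c" "g \<in> pl_plus"
    "\<And>t. - real n \<le> t \<Longrightarrow> t \<le> real n \<Longrightarrow> app (aff 0 c + g) t = line_to_unit t"
proof -
  \<comment> \<open>Subtracting \<open>c\<close> makes \<open>- n\<close> a fixed point, the
    starting condition of the interpolation.\<close>
  define c where "c = line_to_unit (- real n) + real n"
  define f where "f t = line_to_unit t - c" for t
  define a where "a i = - real n + real i" for i
  have "\<exists>(e::int) d. \<forall>t\<in>{a i..a (Suc i)}. f t = 2 powi e * t + d" for i
  proof -
    obtain e d where "\<forall>t\<in>{of_int (int i - int n)..of_int (int i - int n) + 1}.
        line_to_unit t = 2 powi e * t + d"
      using line_to_unit_affine by blast
    then have "\<forall>t\<in>{a i..a (Suc i)}. f t = 2 powi e * t + (d - c)"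
      by (simp add: a_def f_def)
    then show ?thesis by blast
  qed
  moreover have "dyadic (a i)" for i
    unfolding a_def by (metis dyadic_add dyadic_of_int dyadic_uminus of_int_of_nat_eq)
  ultimately obtain g where g: "g \<in> pl_plus" "\<forall>t\<in>{a 0..a (2 * n)}. app g t = f t"
    using pl_plus_interpolate[of "2 * n" a f 0] by (force simp: a_def[abs_def] f_def c_def)
  have "dyadic c"
    unfolding c_def line_to_unit_nat
    by (metis dyadic_add dyadic_1 dyadic_divide_numeral dyadic_of_int of_int_of_nat_eq)
  moreover have "app (aff 0 c + g) t = line_to_unit t" if "- real n \<le> t" "t \<le> real n" for t
    using g(2) that by (simp add: a_def f_def)
  ultimately show thesis using g(1) that by blast
qed

lemma line_to_unit_less_iff [simp]: "line_to_unit s < line_to_unit t \<longleftrightarrow> s < t"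
proof -
  obtain n where n: "\<bar>s\<bar> + \<bar>t\<bar> \<le> real n" using real_arch_simple by blast
  obtain c g where "\<And>t. - real n \<le> t \<Longrightarrow> t \<le> real n \<Longrightarrow> app (aff 0 c + g) t = line_to_unit t"
    using line_to_unit_interpolate[of n] by blast
  from this[of s] this[of t] show ?thesis
    using n app_less_iff[of "aff 0 c + g" s t] by simp
qed

lemma line_to_unit_le_iff [simp]: "line_to_unit s \<le> line_to_unit t \<longleftrightarrow> s \<le> t"
  by (simp flip: not_less)

lemma line_to_unit_surj:
  assumes "0 < s" "s < 1" obtains t where "s = line_to_unit t"
proof -
  obtain n where n: "(1 / 2) ^ n < min s (1 - s)"
    using real_arch_pow_inv[of "min s (1 - s)" "1 / 2"] assms by auto
  have "1 / 2 ^ Suc n \<le> (1 / 2 :: real) ^ n" by (simp add: power_divide field_simps)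
  then have s: "line_to_unit (- real n) \<le> s" "s \<le> line_to_unit (real n)"
    unfolding line_to_unit_nat using n by auto
  obtain c g where g: "\<And>t. - real n \<le> t \<Longrightarrow> t \<le> real n \<Longrightarrow> app (aff 0 c + g) t = line_to_unit t"
    using line_to_unit_interpolate[of n] by blast
  define t where "t = app (- (aff 0 c + g)) s"
  have "- real n \<le> t" "t \<le> real n"
    unfolding t_def le_app_uminus_iff app_uminus_le_iff using s g by auto
  from g[OF this] have "s = line_to_unit t" unfolding t_def by simp
  then show thesis by (rule that)
qed

lemma line_to_unit_bounds: "0 < line_to_unit t" "line_to_unit t < 1"
proof -
  obtain n where n: "\<bar>t\<bar> \<le> real n" using real_arch_simple by blast
  have "line_to_unit (- real n) \<le> line_to_unit t" "line_to_unit t \<le> line_to_unit (real n)"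
    using n by auto
  moreover have "(0::real) < 1 / 2 ^ Suc n" by simp
  ultimately show "0 < line_to_unit t" "line_to_unit t < 1"
    unfolding line_to_unit_nat by linarith+
qed

text \<open>On \<open>[-n, n]\<close> with \<open>n\<close> large, \<open>line_to_unit\<close> may
  be replaced by the line map \<sigma>, and outside that interval both sides involve only fixed
  points. The translation part of \<sigma> is not in \<open>pl_plus\<close> but normalizes
  it.\<close>

lemma conj_to_line:
  assumes f: "f \<in> F_homeo" and "\<epsilon> > 0"
    and low: "\<And>t. t \<le> \<epsilon> \<Longrightarrow> app f t = t" and high: "\<And>t. t \<ge> 1 - \<epsilon> \<Longrightarrow> app f t = t"
  shows "\<exists>k\<in>pl_compact. \<forall>t. app f (line_to_unit t) = line_to_unit (app k t)"
proof -
  obtain n where n: "(1 / 2) ^ n < \<epsilon>"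
    using real_arch_pow_inv[of \<epsilon> "1 / 2"] \<open>\<epsilon> > 0\<close> by auto
  have "1 / 2 ^ Suc n \<le> (1 / 2 :: real) ^ n" by (simp add: power_divide field_simps)
  then have ends: "line_to_unit (- real n) \<le> \<epsilon>" "line_to_unit (real n) \<ge> 1 - \<epsilon>"
    unfolding line_to_unit_nat using n by auto
  obtain c g where c: "dyadic c" and g: "g \<in> pl_plus" and
    eq: "\<And>t. - real n \<le> t \<Longrightarrow> t \<le> real n \<Longrightarrow> app (aff 0 c + g) t = line_to_unit t"
    using line_to_unit_interpolate[of n] by blast
  define \<sigma> where "\<sigma> = aff 0 c + g"
  define k where "k = - \<sigma> + f + \<sigma>"
  have \<sigma>: "app \<sigma> t = line_to_unit t" if "- real n \<le> t" "t \<le> real n" for t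
    using eq that by (simp add: \<sigma>_def)
  have \<sigma>k: "app \<sigma> (app k t) = app f (app \<sigma> t)" for t by (simp add: k_def)
  have neg: "aff 0 (- c) = - aff 0 c" using aff_uminus[of 0 c] by simp
  have "k = - g + (aff 0 (- c) + f - aff 0 (- c)) + g"
    unfolding k_def \<sigma>_def neg by (simp only: group_normalize)
  moreover have "aff 0 (- c) + f - aff 0 (- c) \<in> pl_plus"
    using f c by (intro pl_plus_conj_aff) (auto simp: F_homeo_def)
  ultimately have "k \<in> pl_plus"
    using g by (auto intro!: subgrp_add[OF subgrp_pl_plus] subgrp_uminus[OF subgrp_pl_plus])
  have fix_k: "app k t = t" if "t \<le> - real n \<or> t \<ge> real n" for t
  proof -
    have "app \<sigma> t \<le> line_to_unit (- real n) \<or> app \<sigma> t \<ge> line_to_unit (real n)"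
      using that \<sigma>[of "- real n"] \<sigma>[of "real n"]
      by (metis app_le_iff le_minus_iff neg_le_0_iff_le of_nat_0_le_iff order_refl order_trans)
    then have "app \<sigma> t \<le> \<epsilon> \<or> app \<sigma> t \<ge> 1 - \<epsilon>" using ends by linarith
    then have "app f (app \<sigma> t) = app \<sigma> t" using low high by blast
    then have "app \<sigma> (app k t) = app \<sigma> t" by (simp add: \<sigma>k)
    then show ?thesis by simp
  qed
  then have "agree_top k 0" unfolding agree_top_def by (intro exI[of _ "real n"]) simp
  have "app f (line_to_unit t) = line_to_unit (app k t)" for t
  proof (cases "- real n \<le> t \<and> t \<le> real n")
    case True
    then have "app k (- real n) \<le> app k t" "app k t \<le> app k (real n)" by auto
    then have "- real n \<le> app k t" "app k t \<le> real n" using fix_k by auto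
    then show ?thesis using True \<sigma>k[of t] \<sigma> by simp
  next
    case False
    then have "line_to_unit t \<le> line_to_unit (- real n) \<or> line_to_unit t \<ge> line_to_unit (real n)"
      by auto
    then have "line_to_unit t \<le> \<epsilon> \<or> line_to_unit t \<ge> 1 - \<epsilon>" using ends by linarith
    then have "app f (line_to_unit t) = line_to_unit t" using low high by blast
    then show ?thesis using False fix_k[of t] by auto
  qed
  then show ?thesis using \<open>k \<in> pl_plus\<close> \<open>agree_top k 0\<close> unfolding pl_compact_def by blast
qed

section \<open>The two generators on the unit interval\<close>

text \<open>The form of \<open>aff 0 1\<close> on the unit interval, a standard generator of F up to
  inversion.\<close>

definition gen_x :: line_homeo where
  "gen_x = kink 1 1 + kink (3/4) (- 1) + kink (1/2) (- 1) + kink 0 1"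

text \<open>The form of \<open>bend + aff 0 1 - bend\<close> on the unit interval; the centres are
  the images of the breakpoints 0, 1/8, 1/4, 3/4, 13/16, 7/8, 1 in reverse order.\<close>

definition gen_y :: line_homeo where
  "gen_y = kink 1 2 + kink (31/32) (- 1) + kink (15/16) (- 1) + kink (7/8) 2 +
    kink (3/4) (- 4) + kink (1/4) 1 + kink 0 1"

lemma app_gen_x: "app gen_x t =
   (if t \<le> 0 then t else if t \<le> 1/4 then 2 * t else if t \<le> 1/2 then t + 1/4
    else if t \<le> 1 then (t + 1) / 2 else t)"
  by (auto simp: gen_x_def app_kink power_int_minus field_simps)

lemma app_gen_y: "app gen_y t =
   (if t \<le> 0 then t else if t \<le> 1/8 then 2 * t else if t \<le> 1/4 then 4 * t - 1/4
    else if t \<le> 3/4 then t/4 + 11/16 else if t \<le> 13/16 then t + 1/8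
    else if t \<le> 7/8 then t/2 + 17/32 else if t \<le> 1 then t/4 + 3/4 else t)"
proof -
  have [simp]: "(2::real) powi (- 4) = 1/16" by (simp add: power_int_minus)
  consider "t \<le> 0" | "0 < t" "t \<le> 1/8" | "1/8 < t" "t \<le> 1/4" | "1/4 < t" "t \<le> 3/4"
    | "3/4 < t" "t \<le> 13/16" | "13/16 < t" "t \<le> 7/8" | "7/8 < t" "t \<le> 1" | "1 < t" by linarith
  then show ?thesis
    by cases (simp_all add: gen_y_def app_kink power_int_minus field_simps)
qed

lemma dyadic_fraction: "dyadic (of_int k / 2 ^ n)"
  unfolding dyadic_def by blast

lemma gen_x_in_F: "gen_x \<in> F_homeo" and gen_y_in_F: "gen_y \<in> F_homeo"
proof -
  have d: "dyadic (1/4)" "dyadic (3/4)" "dyadic (1/2)" "dyadic (7/8)" "dyadic (15/16)" "dyadic (31/32)"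
    using dyadic_fraction[of 1 2] dyadic_fraction[of 3 2] dyadic_fraction[of 1 1]
      dyadic_fraction[of 7 3] dyadic_fraction[of 15 4] dyadic_fraction[of 31 5] by simp_all
  have "gen_x \<in> pl_plus" "gen_y \<in> pl_plus"
    unfolding gen_x_def gen_y_def
    by (intro subgrp_add[OF subgrp_pl_plus] kink_in_pl_plus d dyadic_0 dyadic_1)+
  then show "gen_x \<in> F_homeo" "gen_y \<in> F_homeo"
    by (auto simp: F_homeo_def app_gen_x app_gen_y)
qed

lemma gen_x_conj: "app gen_x (line_to_unit t) = line_to_unit (app (aff 0 1) t)"
proof -
  have v: "line_to_unit (- 1) = 1/4" "line_to_unit 0 = 1/2" by (simp_all add: line_to_unit_mid)
  consider "t \<le> -1" | "-1 \<le> t" "t \<le> 0" | "0 \<le> t" by linarith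
  then show ?thesis
  proof cases
    case 1
    then have "line_to_unit t \<le> 1/4" using v by (metis line_to_unit_le_iff)
    then show ?thesis
      using 1 line_to_unit_bounds[of t] by (simp add: app_gen_x line_to_unit_add_low)
  next
    case 2
    then show ?thesis by (auto simp: app_gen_x line_to_unit_mid)
  next
    case 3
    then have "line_to_unit t \<ge> 1/2" using v by (metis line_to_unit_le_iff)
    then show ?thesis
      using 3 line_to_unit_bounds[of t] by (simp add: app_gen_x line_to_unit_add_high)
  qed
qed

lemma app_conj_bend: "app (bend + aff 0 1 - bend) t =
   (if t \<le> -2 then t + 1 else if t \<le> -1 then 2 * t + 3 else if t \<le> 1 then (t + 3) / 2
    else if t \<le> 2 then 2 * t else t + 2)"
proof -
  have "app (- bend) t = (if t \<le> -1 then t else if t \<le> 1 then (t - 1) / 2 else if t \<le> 2 then t - 1 else t / 2)"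
    unfolding app_uminus_eq_iff app_bend by (simp add: field_simps)
  moreover consider "t \<le> -2" | "-2 < t" "t \<le> -1" | "-1 < t" "t \<le> 1" | "1 < t" "t \<le> 2" | "2 < t"
    by linarith
  ultimately show ?thesis
    by cases (simp_all add: app_bend field_simps)
qed

lemma gen_y_conj: "app gen_y (line_to_unit t) = line_to_unit (app (bend + aff 0 1 - bend) t)"
proof -
  have r1: "line_to_unit t = (t + 3) / 8" if "-2 \<le> t" "t \<le> -1" for t
    using that line_to_unit_add_low[of t] line_to_unit_mid[of "t + 1"] by simp
  have r2: "line_to_unit t = (t + 5) / 8" if "1 \<le> t" "t \<le> 2" for t
    using that line_to_unit_add_high[of "t - 1"] line_to_unit_mid[of "t - 1"] by (simp add: field_simps)
  have r3: "line_to_unit t = (t + 12) / 16" if "2 \<le> t" "t \<le> 3" for t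
    using that line_to_unit_add_high[of "t - 1"] r2[of "t - 1"] by (simp add: field_simps)
  have r4: "line_to_unit t = (t + 27) / 32" if "3 \<le> t" "t \<le> 4" for t
    using that line_to_unit_add_high[of "t - 1"] r3[of "t - 1"] by (simp add: field_simps)
  have v: "line_to_unit (- 2) = 1/8" "line_to_unit 2 = 7/8" by (simp_all add: r1 r2)
  \<comment> \<open>The cut at 3/2 is where the image \<open>2 * t\<close> reaches the break 3 of
    \<open>line_to_unit\<close>.\<close>
  consider "t \<le> -2" | "-2 < t" "t \<le> -1" | "-1 < t" "t \<le> 1" | "1 < t" "t \<le> 3/2" | "3/2 < t" "t \<le> 2"
    | "2 < t" by linarith
  then show ?thesis
  proof cases
    case 1
    then have "line_to_unit t \<le> 1/8" using v by (metis line_to_unit_le_iff)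
    then show ?thesis
      using 1 line_to_unit_bounds[of t] by (simp add: app_gen_y app_conj_bend line_to_unit_add_low del: app_diff app_add)
  next
    case 6
    then have "line_to_unit t > 7/8" using v by (metis line_to_unit_less_iff)
    moreover have "line_to_unit (t + 2) = (3 + line_to_unit t) / 4"
      using 6 line_to_unit_add_high[of t] line_to_unit_add_high[of "t + 1"] by (simp add: add.commute)
    ultimately show ?thesis
      using 6 line_to_unit_bounds[of t] by (simp add: app_gen_y app_conj_bend del: app_diff app_add)
  qed (simp_all add: app_gen_y app_conj_bend r1 r2 r3 r4 line_to_unit_mid field_simps del: app_diff app_add)
qed

section \<open>End slopes and cosets\<close>

text \<open>The binary logarithms of the slopes at 0 and at 1; on F this pair is the abelianization
  map onto pairs of integers.\<close>

definition end_slopes :: "line_homeo \<Rightarrow> int \<Rightarrow> int \<Rightarrow> bool" where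
  "end_slopes f a b \<longleftrightarrow> (\<exists>\<epsilon>>0. \<forall>t. 0 \<le> t \<and> t \<le> \<epsilon> \<longrightarrow>
     app f t = 2 powi a * t \<and> app f (1 - t) = 1 - 2 powi b * t)"

lemma end_slopes_exist:
  assumes f: "f \<in> F_homeo" shows "\<exists>a b. end_slopes f a b"
proof -
  obtain S where S: "finite S" and
    aff: "\<And>u v. u < v \<Longrightarrow> {u<..<v} \<inter> S = {} \<Longrightarrow>
      \<exists>(e::int) c. \<forall>t\<in>{u..v}. app f t = 2 powi e * t + c"
    using pl_plus_finite_breaks[of f] f unfolding F_homeo_def by blast
  \<comment> \<open>Positive distances of breaks from 0 and from 1, with 1 added to make the set
    nonempty; the minimum bounds a break-free zone at both ends.\<close>
  define B where "B = insert 1 ({s \<in> S. s > 0} \<union> (\<lambda>s. 1 - s) ` {s \<in> S. s < 1})"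
  have "finite B" "B \<noteq> {}" using S by (auto simp: B_def)
  define \<epsilon> where "\<epsilon> = Min B"
  have \<epsilon>: "\<epsilon> \<le> b" if "b \<in> B" for b using that \<open>finite B\<close> by (simp add: \<epsilon>_def)
  have "\<epsilon> \<in> B" unfolding \<epsilon>_def using \<open>finite B\<close> \<open>B \<noteq> {}\<close> by (rule Min_in)
  then have "\<epsilon> > 0" by (auto simp: B_def)
  have "{0<..<\<epsilon>} \<inter> S = {}"
  proof (rule ccontr)
    assume "{0<..<\<epsilon>} \<inter> S \<noteq> {}"
    then obtain s where "0 < s" "s < \<epsilon>" "s \<in> S" by auto
    then show False using \<epsilon>[of s] by (simp add: B_def)
  qed
  then obtain a c where a: "\<forall>t\<in>{0..\<epsilon>}. app f t = 2 powi a * t + c"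
    using aff[of 0 \<epsilon>] \<open>\<epsilon> > 0\<close> by blast
  have "{1 - \<epsilon><..<1} \<inter> S = {}"
  proof (rule ccontr)
    assume "{1 - \<epsilon><..<1} \<inter> S \<noteq> {}"
    then obtain s where "1 - \<epsilon> < s" "s < 1" "s \<in> S" by auto
    moreover from this have "1 - s \<in> B" unfolding B_def by blast
    ultimately show False using \<epsilon>[of "1 - s"] by simp
  qed
  then obtain b d where b: "\<forall>t\<in>{1 - \<epsilon>..1}. app f t = 2 powi b * t + d"
    using aff[of "1 - \<epsilon>" 1] \<open>\<epsilon> > 0\<close> by auto
  have "app f 0 = 0" "app f 1 = 1" using F_homeo_fix[OF f] by auto
  then have "c = 0" "d = 1 - 2 powi b" using a b \<open>\<epsilon> > 0\<close> by auto
  then have "end_slopes f a b"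
    unfolding end_slopes_def using a b \<open>\<epsilon> > 0\<close> by (intro exI[of _ \<epsilon>]) (auto simp: algebra_simps)
  then show ?thesis by blast
qed

lemma end_slopes_add:
  assumes "end_slopes f a b" "end_slopes g a' b'"
  shows "end_slopes (f + g) (a + a') (b + b')"
proof -
  obtain \<epsilon> where \<epsilon>: "\<epsilon> > 0" "\<And>t. 0 \<le> t \<Longrightarrow> t \<le> \<epsilon> \<Longrightarrow> app f t = 2 powi a * t"
    "\<And>t. 0 \<le> t \<Longrightarrow> t \<le> \<epsilon> \<Longrightarrow> app f (1 - t) = 1 - 2 powi b * t"
    using assms(1) unfolding end_slopes_def by blast
  obtain \<delta> where \<delta>: "\<delta> > 0" "\<And>t. 0 \<le> t \<Longrightarrow> t \<le> \<delta> \<Longrightarrow> app g t = 2 powi a' * t"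
    "\<And>t. 0 \<le> t \<Longrightarrow> t \<le> \<delta> \<Longrightarrow> app g (1 - t) = 1 - 2 powi b' * t"
    using assms(2) unfolding end_slopes_def by blast
  define \<eta> where "\<eta> = min \<delta> (min (\<epsilon> / 2 powi a') (\<epsilon> / 2 powi b'))"
  have "\<eta> > 0" using \<epsilon> \<delta> by (simp add: \<eta>_def)
  moreover have "app (f + g) t = 2 powi (a + a') * t \<and> app (f + g) (1 - t) = 1 - 2 powi (b + b') * t"
    if t: "0 \<le> t" "t \<le> \<eta>" for t
  proof -
    have "t \<le> \<delta>" "t \<le> \<epsilon> / 2 powi a'" "t \<le> \<epsilon> / 2 powi b'" using t by (auto simp: \<eta>_def)
    then have "t \<le> \<delta>" "2 powi a' * t \<le> \<epsilon>" "2 powi b' * t \<le> \<epsilon>" by (auto simp: field_simps)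
    then show ?thesis using \<epsilon> \<delta> t by (simp add: power_int_add)
  qed
  ultimately show ?thesis unfolding end_slopes_def by blast
qed

lemma end_slopes_0: "end_slopes 0 0 0"
  unfolding end_slopes_def by (intro exI[of _ 1]) simp

lemma end_slopes_0_unique:
  assumes "end_slopes 0 a b" shows "a = 0" "b = 0"
proof -
  obtain \<epsilon> :: real where "\<epsilon> > 0" and
    *: "\<And>t. 0 \<le> t \<Longrightarrow> t \<le> \<epsilon> \<Longrightarrow> t = 2 powi a * t \<and> 1 - t = 1 - 2 powi b * t"
    using assms unfolding end_slopes_def app_zero by blast
  then have "(2::real) powi a = 2 powi 0" "(2::real) powi b = 2 powi 0" using *[of \<epsilon>] by auto
  then show "a = 0" "b = 0" using two_powi_inject by blast+
qed

text \<open>The inverse has some end slopes; added to those of \<open>f\<close> they give end slopes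
  of the identity, which are 0.\<close>

lemma end_slopes_uminus:
  assumes "f \<in> F_homeo" "end_slopes f a b" shows "end_slopes (- f) (- a) (- b)"
proof -
  obtain a' b' where *: "end_slopes (- f) a' b'"
    using end_slopes_exist[OF subgrp_uminus[OF subgrp_F_homeo assms(1)]] by blast
  have "end_slopes 0 (a + a') (b + b')" using end_slopes_add[OF assms(2) *] by simp
  then have "a' = - a" "b' = - b" using end_slopes_0_unique by fastforce+
  with * show ?thesis by simp
qed

lemma end_slopes_diff:
  "g \<in> F_homeo \<Longrightarrow> end_slopes f a b \<Longrightarrow> end_slopes g a' b' \<Longrightarrow> end_slopes (f - g) (a - a') (b - b')"
  using end_slopes_add[of f a b "- g" "- a'" "- b'"] end_slopes_uminus by simp

lemma end_slopes_gen_x: "end_slopes gen_x 1 (- 1)"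
  unfolding end_slopes_def
  by (intro exI[of _ "1/8"]) (auto simp: app_gen_x power_int_minus field_simps)

lemma end_slopes_gen_y: "end_slopes gen_y 1 (- 2)"
  unfolding end_slopes_def
  by (intro exI[of _ "1/16"]) (auto simp: app_gen_y power_int_minus field_simps)

section \<open>The subgroup generated by the two powers\<close>

locale generator_powers =
  fixes m n :: nat
  assumes m_pos: "m > 0" and n_pos: "n > 0"
begin

abbreviation power_subgroup :: "(real \<Rightarrow> real) set" where
  "power_subgroup \<equiv> generate thompson_F
     {app gen_x [^]\<^bsub>thompson_F\<^esub> m, app gen_y [^]\<^bsub>thompson_F\<^esub> n}"

lemma generators_in_carrier: "app gen_x \<in> carrier thompson_F" "app gen_y \<in> carrier thompson_F"
  using gen_x_in_F gen_y_in_F by (auto simp: carrier_thompson_F)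

lemma subgroup_power_subgroup: "subgroup power_subgroup thompson_F"
  using generators_in_carrier group.is_monoid[OF group_thompson_F]
  by (intro group.generate_is_subgroup[OF group_thompson_F]) (auto intro: monoid.nat_pow_closed)

lemma power_subgroup_subset: "power_subgroup \<subseteq> app ` F_homeo"
  using subgroup.subset[OF subgroup_power_subgroup] by (simp add: carrier_thompson_F)

lemma power_subgroup_comp: "f \<in> power_subgroup \<Longrightarrow> g \<in> power_subgroup \<Longrightarrow> f \<circ> g \<in> power_subgroup"
  using subgroup.m_closed[OF subgroup_power_subgroup] by (simp add: mult_thompson_F)

lemma power_subgroup_one: "app 0 \<in> power_subgroup"
  using subgroup.one_closed[OF subgroup_power_subgroup] by (simp add: one_thompson_F)

lemma power_subgroup_inv: "g \<in> F_homeo \<Longrightarrow> app g \<in> power_subgroup \<Longrightarrow> app (- g) \<in> power_subgroup"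
  using subgroup.m_inv_closed[OF subgroup_power_subgroup, of "app g"] by (simp add: inv_thompson_F)

text \<open>The power subgroup transported to the line, by an intertwining relation because
  \<open>line_to_unit\<close> maps onto the open interval only and is no
  \<open>line_homeo\<close>.\<close>

definition line_subgroup :: "line_homeo set" where
  "line_subgroup = {h. \<exists>f\<in>power_subgroup. \<forall>t. f (line_to_unit t) = line_to_unit (app h t)}"

lemma subgrp_line_subgroup: "subgrp line_subgroup"
proof (rule subgrpI)
  show "0 \<in> line_subgroup"
    unfolding line_subgroup_def using power_subgroup_one by (auto intro!: bexI[of _ "app 0"])
  show "a + b \<in> line_subgroup" if ab: "a \<in> line_subgroup" "b \<in> line_subgroup" for a b
  proof -
    obtain f g where "f \<in> power_subgroup" "\<forall>t. f (line_to_unit t) = line_to_unit (app a t)"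
      and "g \<in> power_subgroup" "\<forall>t. g (line_to_unit t) = line_to_unit (app b t)"
      using ab unfolding line_subgroup_def by blast
    then have "f \<circ> g \<in> power_subgroup" "\<forall>t. (f \<circ> g) (line_to_unit t) = line_to_unit (app (a + b) t)"
      using power_subgroup_comp by auto
    then show ?thesis unfolding line_subgroup_def by blast
  qed
  show "- a \<in> line_subgroup" if a: "a \<in> line_subgroup" for a
  proof -
    obtain f where f: "f \<in> power_subgroup" "\<forall>t. f (line_to_unit t) = line_to_unit (app a t)"
      using a unfolding line_subgroup_def by blast
    then obtain g where g: "g \<in> F_homeo" "f = app g" using power_subgroup_subset by blast
    have "app (- g) (line_to_unit t) = line_to_unit (app (- a) t)" for t
      using f(2)[rule_format, of "app (- a) t"] by (simp add: app_uminus_eq_iff g)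
    moreover have "app (- g) \<in> power_subgroup" using f g power_subgroup_inv by simp
    ultimately show ?thesis unfolding line_subgroup_def by blast
  qed
qed

lemma pow_gen_x: "(app gen_x [^]\<^bsub>thompson_F\<^esub> k) (line_to_unit t) = line_to_unit (app (aff 0 (real k)) t)"
proof (induction k arbitrary: t)
  case (Suc k)
  then show ?case by (simp add: mult_thompson_F gen_x_conj add.assoc)
qed (simp add: one_thompson_F)

lemma pow_gen_y:
  "(app gen_y [^]\<^bsub>thompson_F\<^esub> k) (line_to_unit t) = line_to_unit (app (bend + aff 0 (real k) - bend) t)"
proof (induction k arbitrary: t)
  case (Suc k)
  then show ?case by (simp add: mult_thompson_F gen_y_conj add.assoc)
qed (simp add: one_thompson_F)

lemma translation_in_line_subgroup: "aff 0 (of_int j * real m) \<in> line_subgroup"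
proof (rule subgrp_int_family[OF subgrp_line_subgroup])
  have "app gen_x [^]\<^bsub>thompson_F\<^esub> m \<in> power_subgroup" by (rule generate.incl) simp
  then have "aff 0 (real m) \<in> line_subgroup"
    unfolding line_subgroup_def using pow_gen_x[of m] by blast
  then show "aff 0 (of_int 1 * real m) \<in> line_subgroup" by simp
qed (simp add: aff_add algebra_simps)

lemma conj_translation_in_line_subgroup: "bend + aff 0 (of_int j * real n) - bend \<in> line_subgroup"
proof (rule subgrp_int_family[OF subgrp_line_subgroup])
  have "app gen_y [^]\<^bsub>thompson_F\<^esub> n \<in> power_subgroup" by (rule generate.incl) simp
  then have "bend + aff 0 (real n) - bend \<in> line_subgroup"
    unfolding line_subgroup_def using pow_gen_y[of n] by blast
  then show "bend + aff 0 (of_int 1 * real n) - bend \<in> line_subgroup" by simp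
  fix i j :: int
  have "bend + (aff 0 (of_int i * real n) + aff 0 (of_int j * real n)) - bend =
    (bend + aff 0 (of_int i * real n) - bend) + (bend + aff 0 (of_int j * real n) - bend)"
    by (simp only: group_normalize)
  then show "bend + aff 0 (of_int (i + j) * real n) - bend =
    (bend + aff 0 (of_int i * real n) - bend) + (bend + aff 0 (of_int j * real n) - bend)"
    by (simp add: aff_add algebra_simps)
qed

text \<open>A common multiple of \<open>m\<close> and \<open>n\<close> serves as the single
  exponent.\<close>

sublocale translation_powers "m * n" line_subgroup
proof
  show "m * n > 0" using m_pos n_pos by simp
  show "subgrp line_subgroup" by (rule subgrp_line_subgroup)
  fix j :: int
  show "aff 0 (of_int j * real (m * n)) \<in> line_subgroup"
    using translation_in_line_subgroup[of "j * int n"] by (simp add: algebra_simps)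
  show "bend + aff 0 (of_int j * real (m * n)) - bend \<in> line_subgroup"
    using conj_translation_in_line_subgroup[of "j * int m"] by (simp add: algebra_simps)
qed

text \<open>On the line \<open>f\<close> becomes a compactly supported map, which
  \<open>line_subgroup\<close> contains. The element of the power subgroup realizing it agrees with
  \<open>f\<close> on the image of \<open>line_to_unit\<close>, the open interval, and both fix all
  other points.\<close>

lemma trivial_ends_in_power_subgroup:
  assumes f: "f \<in> F_homeo" "end_slopes f 0 0"
  shows "app f \<in> power_subgroup"
proof -
  obtain \<epsilon> where \<epsilon>: "\<epsilon> > 0" "\<forall>t. 0 \<le> t \<and> t \<le> \<epsilon> \<longrightarrow> app f t = t \<and> app f (1 - t) = 1 - t"
    using f(2) by (auto simp: end_slopes_def)
  have low: "app f t = t" if "t \<le> \<epsilon>" for t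
    using that \<epsilon>(2) F_homeo_fix[OF f(1), of t] by (cases "t \<le> 0") auto
  have high: "app f t = t" if "t \<ge> 1 - \<epsilon>" for t
    using that \<epsilon>(2)[rule_format, of "1 - t"] F_homeo_fix[OF f(1), of t] by (cases "t \<ge> 1") auto
  obtain k where k: "k \<in> pl_compact" "\<forall>t. app f (line_to_unit t) = line_to_unit (app k t)"
    using conj_to_line[OF f(1) \<epsilon>(1) low high] by blast
  then have "k \<in> line_subgroup" using pl_compact_subset_H by blast
  then obtain f' where f': "f' \<in> power_subgroup" "\<forall>t. f' (line_to_unit t) = line_to_unit (app k t)"
    unfolding line_subgroup_def by blast
  obtain g where g: "g \<in> F_homeo" "f' = app g" using f'(1) power_subgroup_subset by blast
  have "app g s = app f s" for s
  proof (cases "s \<le> 0 \<or> s \<ge> 1")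
    case True
    then show ?thesis using F_homeo_fix[OF f(1)] F_homeo_fix[OF g(1)] by simp
  next
    case False
    then obtain t where "s = line_to_unit t" using line_to_unit_surj[of s] by auto
    then show ?thesis using k(2) f'(2) g by simp
  qed
  then have "f' = app f" using g by auto
  then show ?thesis using f'(1) by simp
qed

section \<open>Realizing end slopes and counting cosets\<close>

definition homeo_subgroup :: "line_homeo set" where
  "homeo_subgroup = {g \<in> F_homeo. app g \<in> power_subgroup}"

lemma subgrp_homeo_subgroup: "subgrp homeo_subgroup"
proof (rule subgrpI)
  show "0 \<in> homeo_subgroup"
    using power_subgroup_one subgrp_zero[OF subgrp_F_homeo] by (simp add: homeo_subgroup_def)
  show "a + b \<in> homeo_subgroup" if "a \<in> homeo_subgroup" "b \<in> homeo_subgroup" for a b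
    using that power_subgroup_comp[of "app a" "app b"] subgrp_add[OF subgrp_F_homeo]
    by (simp add: homeo_subgroup_def app_comp)
  show "- a \<in> homeo_subgroup" if "a \<in> homeo_subgroup" for a
    using that power_subgroup_inv subgrp_uminus[OF subgrp_F_homeo] by (simp add: homeo_subgroup_def)
qed

lemma power_homeo:
  assumes "g \<in> F_homeo" "end_slopes g a b"
  shows "\<exists>h\<in>F_homeo. app g [^]\<^bsub>thompson_F\<^esub> k = app h \<and> end_slopes h (int k * a) (int k * b)"
proof (induction k)
  case 0
  show ?case
    using subgrp_zero[OF subgrp_F_homeo] end_slopes_0 by (intro bexI[of _ 0]) (auto simp: one_thompson_F)
next
  case (Suc k)
  then obtain h where h: "h \<in> F_homeo" "app g [^]\<^bsub>thompson_F\<^esub> k = app h"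
    "end_slopes h (int k * a) (int k * b)" by blast
  have "end_slopes (h + g) (int (Suc k) * a) (int (Suc k) * b)"
    using end_slopes_add[OF h(3) assms(2)] by (simp add: algebra_simps)
  then show ?case
    using h assms subgrp_add[OF subgrp_F_homeo] by (intro bexI[of _ "h + g"]) (auto simp: mult_thompson_F app_comp)
qed

text \<open>The end slopes \<open>(1, -1)\<close> and \<open>(1, -2)\<close> of the generators form
  a basis of the integer lattice, so their multiples by \<open>m\<close> and \<open>n\<close> span a
  lattice containing all multiples of \<open>m * n\<close>.\<close>

lemma end_slopes_realized:
  "\<exists>h\<in>homeo_subgroup. end_slopes h (int (m * n) * q) (int (m * n) * r)"
proof -
  define E where "E = {(a, b). \<exists>h\<in>homeo_subgroup. end_slopes h a b}"
  have E: "subgrp E"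
  proof (rule subgrpI)
    show "0 \<in> E" unfolding E_def zero_prod_def
      using end_slopes_0 subgrp_zero[OF subgrp_homeo_subgroup] by blast
    show "u + v \<in> E" if uv: "u \<in> E" "v \<in> E" for u v
    proof -
      obtain a b c d h k where *: "u = (a, b)" "v = (c, d)"
        "h \<in> homeo_subgroup" "end_slopes h a b" "k \<in> homeo_subgroup" "end_slopes k c d"
        using uv unfolding E_def by blast
      then have "h + k \<in> homeo_subgroup" "end_slopes (h + k) (a + c) (b + d)"
        using subgrp_add[OF subgrp_homeo_subgroup] end_slopes_add by blast+
      then show ?thesis unfolding * E_def by auto
    qed
    show "- u \<in> E" if u: "u \<in> E" for u
    proof -
      obtain a b h where *: "u = (a, b)" "h \<in> homeo_subgroup" "end_slopes h a b"
        using u unfolding E_def by blast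
      then have "- h \<in> homeo_subgroup" "end_slopes (- h) (- a) (- b)"
        using subgrp_uminus[OF subgrp_homeo_subgroup] end_slopes_uminus[of h a b]
        by (auto simp: homeo_subgroup_def)
      then show ?thesis unfolding * E_def by auto
    qed
  qed
  have x: "(i * int m, - i * int m) \<in> E" for i
  proof (rule subgrp_int_family[OF E, where x = "\<lambda>i. (i * int m, - i * int m)"])
    obtain h where "h \<in> F_homeo" "app gen_x [^]\<^bsub>thompson_F\<^esub> m = app h"
      "end_slopes h (int m * 1) (int m * - 1)"
      using power_homeo[OF gen_x_in_F end_slopes_gen_x] by blast
    moreover from this have "app h \<in> power_subgroup" by (metis generate.incl insertI1)
    ultimately show "(1 * int m, - 1 * int m) \<in> E"
      unfolding E_def homeo_subgroup_def by auto
  qed (simp add: algebra_simps)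
  have y: "(i * int n, - 2 * i * int n) \<in> E" for i
  proof (rule subgrp_int_family[OF E, where x = "\<lambda>i. (i * int n, - 2 * i * int n)"])
    obtain h where "h \<in> F_homeo" "app gen_y [^]\<^bsub>thompson_F\<^esub> n = app h"
      "end_slopes h (int n * 1) (int n * - 2)"
      using power_homeo[OF gen_y_in_F end_slopes_gen_y] by blast
    moreover from this have "app h \<in> power_subgroup" by (metis generate.incl insertI1 insertI2)
    ultimately show "(1 * int n, - 2 * 1 * int n) \<in> E"
      unfolding E_def homeo_subgroup_def by (auto simp: algebra_simps)
  qed (simp add: algebra_simps)
  \<comment> \<open>Coordinates in that basis:
    \<open>(q, r) = (2 q + r) (1, -1) - (q + r) (1, -2)\<close>.\<close>
  from subgrp_add[OF E x[of "(2 * q + r) * int n"] y[of "- (q + r) * int m"]]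
  have "(int (m * n) * q, int (m * n) * r) \<in> E" by (simp add: algebra_simps)
  then show ?thesis by (simp add: E_def)
qed

text \<open>Some \<open>h\<close> in the subgroup has the same end slopes as \<open>f - g\<close>;
  dividing by it leaves trivial ends.\<close>

lemma cong_end_slopes:
  assumes f: "f \<in> F_homeo" "end_slopes f a b" and g: "g \<in> F_homeo" "end_slopes g a' b'"
    and "[a = a'] (mod int (m * n))" "[b = b'] (mod int (m * n))"
  shows "app (f - g) \<in> power_subgroup"
proof -
  obtain q r where q: "a - a' = int (m * n) * q" "b - b' = int (m * n) * r"
    using assms by (meson cong_iff_dvd_diff dvd_def)
  obtain h where h: "h \<in> homeo_subgroup" "end_slopes h (a - a') (b - b')"
    using end_slopes_realized[of q r] unfolding q by blast
  have hF: "h \<in> F_homeo" using h by (simp add: homeo_subgroup_def)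
  have fg: "f - g \<in> F_homeo" using f g subgrp_diff[OF subgrp_F_homeo] by blast
  have "end_slopes (f - g - h) (a - a' - (a - a')) (b - b' - (b - b'))"
    by (intro end_slopes_diff hF f g h)
  then have "app (f - g - h) \<in> power_subgroup"
    using fg hF subgrp_diff[OF subgrp_F_homeo] by (intro trivial_ends_in_power_subgroup) auto
  then have "f - g - h \<in> homeo_subgroup"
    using fg hF subgrp_diff[OF subgrp_F_homeo] by (simp add: homeo_subgroup_def del: app_diff)
  then have "f - g - h + h \<in> homeo_subgroup" using h subgrp_add[OF subgrp_homeo_subgroup] by blast
  then show ?thesis by (simp add: homeo_subgroup_def)
qed

lemma same_coset:
  assumes "f \<in> F_homeo" "g \<in> F_homeo" "app (f - g) \<in> power_subgroup"
  shows "power_subgroup #>\<^bsub>thompson_F\<^esub> app f = power_subgroup #>\<^bsub>thompson_F\<^esub> app g"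
proof -
  have "app f = app (f - g) \<otimes>\<^bsub>thompson_F\<^esub> app g"
    unfolding mult_thompson_F app_comp by simp
  then have "app f \<in> power_subgroup #>\<^bsub>thompson_F\<^esub> app g"
    using assms(3) unfolding r_coset_def by blast
  then show ?thesis
    using group.repr_independence[OF group_thompson_F _ _ subgroup_power_subgroup, of "app f" "app g"]
      assms(2) by (simp add: carrier_thompson_F)
qed

lemma finite_rcosets: "finite (rcosets\<^bsub>thompson_F\<^esub> power_subgroup)"
proof -
  define Q where "Q d f \<longleftrightarrow> f \<in> F_homeo \<and>
    (\<exists>a b. end_slopes f a b \<and> d = (a mod int (m * n), b mod int (m * n)))" for d f
  define D where "D = {0..<int (m * n)} \<times> {0..<int (m * n)}"
  have "rcosets\<^bsub>thompson_F\<^esub> power_subgroup \<subseteq>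
    (\<lambda>d. power_subgroup #>\<^bsub>thompson_F\<^esub> app (SOME f. Q d f)) ` D"
  proof
    fix C assume "C \<in> rcosets\<^bsub>thompson_F\<^esub> power_subgroup"
    then obtain f where f: "f \<in> F_homeo" "C = power_subgroup #>\<^bsub>thompson_F\<^esub> app f"
      unfolding RCOSETS_def carrier_thompson_F by blast
    obtain a b where ab: "end_slopes f a b" using end_slopes_exist[OF f(1)] by blast
    define d where "d = (a mod int (m * n), b mod int (m * n))"
    have "int (m * n) > 0" using m_pos n_pos by simp
    then have "d \<in> D" unfolding d_def D_def by simp
    have "Q d f" using f ab unfolding Q_def d_def by blast
    then have "Q d (SOME f. Q d f)" by (rule someI)
    then obtain a' b' where g: "(SOME f. Q d f) \<in> F_homeo" "end_slopes (SOME f. Q d f) a' b'"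
      "d = (a' mod int (m * n), b' mod int (m * n))" unfolding Q_def by blast
    have "app (f - (SOME f. Q d f)) \<in> power_subgroup"
      using g(3) by (intro cong_end_slopes[OF f(1) ab g(1,2)]) (simp_all add: d_def cong_def)
    then have "C = power_subgroup #>\<^bsub>thompson_F\<^esub> app (SOME f. Q d f)"
      unfolding f(2) by (rule same_coset[OF f(1) g(1)])
    with \<open>d \<in> D\<close> show "C \<in> (\<lambda>d. power_subgroup #>\<^bsub>thompson_F\<^esub> app (SOME f. Q d f)) ` D"
      by blast
  qed
  moreover have "finite D" by (simp add: D_def)
  ultimately show ?thesis by (meson finite_imageI finite_subset)
qed

end

text \<open>The case \<open>m = n = 1\<close>: modulo 1 all end slopes are congruent to those of the
  identity.\<close>

lemma generate_gens: "generate thompson_F {app gen_x, app gen_y} = carrier thompson_F"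
proof -
  interpret generator_powers 1 1 by unfold_locales auto
  interpret F: group thompson_F by (rule group_thompson_F)
  have eq: "power_subgroup = generate thompson_F {app gen_x, app gen_y}"
    using generators_in_carrier by simp
  have "app f \<in> power_subgroup" if f: "f \<in> F_homeo" for f
  proof -
    obtain a b where "end_slopes f a b" using end_slopes_exist[OF f] by blast
    then show ?thesis
      using cong_end_slopes[OF f _ subgrp_zero[OF subgrp_F_homeo] end_slopes_0] by (simp del: app_diff)
  qed
  then have "carrier thompson_F \<subseteq> power_subgroup" by (auto simp: carrier_thompson_F)
  moreover have "power_subgroup \<subseteq> carrier thompson_F"
    using power_subgroup_subset by (simp add: carrier_thompson_F)
  ultimately show ?thesis unfolding eq by blast
qed

theorem theorem1p1:
  shows "\<exists>x y. x \<in> carrier thompson_F \<and> y \<in> carrier thompson_F \<and> x \<noteq> y \<and>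
           generate thompson_F {x, y} = carrier thompson_F \<and>
           (\<forall>(m::nat) (n::nat). m \<ge> 1 \<longrightarrow> n \<ge> 1 \<longrightarrow>
              finite (rcosets\<^bsub>thompson_F\<^esub>
                        (generate thompson_F {x [^]\<^bsub>thompson_F\<^esub> m, y [^]\<^bsub>thompson_F\<^esub> n})))"
proof (intro exI conjI allI impI)
  show "app gen_x \<in> carrier thompson_F" "app gen_y \<in> carrier thompson_F"
    using gen_x_in_F gen_y_in_F by (auto simp: carrier_thompson_F)
  have "app gen_x (1/4) \<noteq> app gen_y (1/4)" by (simp add: app_gen_x app_gen_y)
  then show "app gen_x \<noteq> app gen_y" by metis
  show "generate thompson_F {app gen_x, app gen_y} = carrier thompson_F" by (rule generate_gens)
  fix m n :: nat assume "m \<ge> 1" "n \<ge> 1"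
  then interpret generator_powers m n by unfold_locales auto
  show "finite (rcosets\<^bsub>thompson_F\<^esub>
    (generate thompson_F {app gen_x [^]\<^bsub>thompson_F\<^esub> m, app gen_y [^]\<^bsub>thompson_F\<^esub> n}))"
    by (rule finite_rcosets)
qed

end
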